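(* Let $d\in\Omega$. Then $d$ has the truncating property if and only if $d$ is not a box metric.
   Context: A norm-derived metric on $\mathbb{R}^2$ is a metric of the form $d(\mathbf{x},\mathbf{y})=\|\mathbf{x}-\mathbf{y}\|$ for some norm $\|\cdot\|$ on $\mathbb{R}^2$; its shape is the unit ball $P=\{\mathbf{x}:\|\mathbf{x}\|\le 1\}$ (a convex, centrally symmetric set with non-empty interior), and the metric with shape $P$ is written $d_P$. A norm-derived metric is polygonal if its shape is a polygon, and smooth if its shape is bounded by a smooth curve. $\Omega$ denotes the set of all norm-derived metrics on $\mathbb{R}^2$ that are polygonal or smooth. A box metric is a metric in $\Omega$ whose shape is a parallelogram. For $V\subseteq\mathbb{R}^2$, a map $f:V\to V$ is a step-isometry if $\lfloor d(\mathbf{u},\mathbf{v})\rfloor=\lfloor d(f(\mathbf{u}),f(\mathbf{v}))\rfloor$ for all $\mathbf{u},\mathbf{v}\in V$, and an isometry if $d(f(\mathbf{u}),f(\mathbf{v}))=d(\mathbf{u},\mathbf{v})$ for all $\mathbf{u},\mathbf{v}\in V$. A metric $d\in\Omega$ has the truncating property if for every countable dense set $V\subseteq\mathbb{R}^2$, every step-isometry $f:V\to V$ is an isometry. *)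

theory Defs
  imports "HOL-Analysis.Analysis"
begin

type_synonym plane = "real^2"

definition is_norm :: "(plane \<Rightarrow> real) \<Rightarrow> bool" where
  "is_norm N \<longleftrightarrow>
     (\<forall>x. N x \<ge> 0) \<and>
     (\<forall>x. N x = 0 \<longleftrightarrow> x = 0) \<and>
     (\<forall>c x. N (c *\<^sub>R x) = \<bar>c\<bar> * N x) \<and>
     (\<forall>x y. N (x + y) \<le> N x + N y)"

definition norm_derived :: "(plane \<Rightarrow> plane \<Rightarrow> real) \<Rightarrow> bool" where
  "norm_derived d \<longleftrightarrow> (\<exists>N. is_norm N \<and> (\<forall>x y. d x y = N (x - y)))"

text \<open>If \<open>d x y = N (x - y)\<close>, then \<open>d x 0 = N x\<close>, so this is the unit ball of \<open>N\<close>.\<close>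

definition shape :: "(plane \<Rightarrow> plane \<Rightarrow> real) \<Rightarrow> plane set" where
  "shape d = {x. d x 0 \<le> 1}"

text \<open>The shape is convex with non-empty interior, so it is a (filled) polygon exactly when
  it is the convex hull of finitely many points, i.e. a polytope.\<close>

definition polygonal_metric :: "(plane \<Rightarrow> plane \<Rightarrow> real) \<Rightarrow> bool" where
  "polygonal_metric d \<longleftrightarrow> norm_derived d \<and> polytope (shape d)"

text \<open>A smooth simple closed curve: the image of a 1-periodic regular \<open>C\<^sup>1\<close> parametrization that is
  injective on a period. Periodicity on all of the reals makes the tangents agree where the
  curve closes up; the non-vanishing derivative excludes corners.\<close>

definition smooth_closed_curve :: "plane set \<Rightarrow> bool" where
  "smooth_closed_curve C \<longleftrightarrow>
     (\<exists>g :: real \<Rightarrow> plane.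
        g C1_differentiable_on UNIV \<and>
        (\<forall>t. vector_derivative g (at t) \<noteq> 0) \<and>
        (\<forall>t. g (t + 1) = g t) \<and>
        inj_on g {0..<1} \<and>
        range g = C)"

definition smooth_metric :: "(plane \<Rightarrow> plane \<Rightarrow> real) \<Rightarrow> bool" where
  "smooth_metric d \<longleftrightarrow> norm_derived d \<and> smooth_closed_curve (frontier (shape d))"

definition Omega :: "(plane \<Rightarrow> plane \<Rightarrow> real) set" where
  "Omega = {d. polygonal_metric d \<or> smooth_metric d}"

definition parallelogram :: "plane set \<Rightarrow> bool" where
  "parallelogram P \<longleftrightarrow>
     (\<exists>a b c. \<not> collinear {a, b, c} \<and> P = convex hull {a, b, c, b + c - a})"

definition box_metric :: "(plane \<Rightarrow> plane \<Rightarrow> real) \<Rightarrow> bool" where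
  "box_metric d \<longleftrightarrow> d \<in> Omega \<and> parallelogram (shape d)"

definition step_isometry_on ::
    "(plane \<Rightarrow> plane \<Rightarrow> real) \<Rightarrow> plane set \<Rightarrow> (plane \<Rightarrow> plane) \<Rightarrow> bool" where
  "step_isometry_on d V f \<longleftrightarrow>
     f \<in> V \<rightarrow> V \<and> (\<forall>u\<in>V. \<forall>v\<in>V. \<lfloor>d u v\<rfloor> = \<lfloor>d (f u) (f v)\<rfloor>)"

definition isometry_on ::
    "(plane \<Rightarrow> plane \<Rightarrow> real) \<Rightarrow> plane set \<Rightarrow> (plane \<Rightarrow> plane) \<Rightarrow> bool" where
  "isometry_on d V f \<longleftrightarrow>
     f \<in> V \<rightarrow> V \<and> (\<forall>u\<in>V. \<forall>v\<in>V. d (f u) (f v) = d u v)"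

definition truncating_property :: "(plane \<Rightarrow> plane \<Rightarrow> real) \<Rightarrow> bool" where
  "truncating_property d \<longleftrightarrow>
     (\<forall>V f. countable V \<and> closure V = UNIV \<and> step_isometry_on d V f \<longrightarrow> isometry_on d V f)"

end

theory Submission
  imports Defs
begin

text \<open>The argument works for every norm \<open>N\<close> on the plane. Call \<open>a\<close> a gradient of \<open>N\<close> if \<open>N\<close>
  is differentiable at some point \<open>p\<close> with derivative \<open>a \<bullet> _\<close>; then
  \<open>N (R p + u + z) - N (R p + u)\<close> tends to \<open>a \<bullet> z\<close> as \<open>R\<close> grows, so large balls look like
  half-planes. Such points are dense, hence \<open>N\<close> is the supremum of its gradients, and if they all
  are multiples of two of them, then the unit ball is a parallelogram. Otherwise there are three
  pairwise independent gradients.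

  A step-isometry \<open>f\<close> distorts distances by less than 1. As in Figiel's theorem, every gradient
  \<open>a\<close> has a counterpart \<open>b\<close> such that \<open>b \<bullet> (f u - f v) - a \<bullet> (u - v)\<close> is bounded, so \<open>f\<close> is
  within bounded distance of a linear isometry, and one may assume that it is the identity.
  Comparing integer distances to far away points shows that \<open>f\<close>
  then is monotone in the direction of every gradient. Monotonicity in three directions yields an
  additive functional equation, so \<open>f\<close> is a translation.

  For a parallelogram, \<open>N\<close> is the maximum norm in suitable coordinates, and one can apply to the
  first coordinate an increasing non-identity map that commutes with integer translations.\<close>

section \<open>Determinants, dual bases and dense sets in the plane\<close>

definition det2 :: "plane \<Rightarrow> plane \<Rightarrow> real" where
  "det2 a b = a $ 1 * b $ 2 - a $ 2 * b $ 1"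

lemma det2_scaleR [simp]: "det2 (s *\<^sub>R a) (t *\<^sub>R b) = s * t * det2 a b"
  by (simp add: det2_def algebra_simps)

lemma det2_eq_0_iff: "det2 a b = 0 \<longleftrightarrow> (\<exists>s t. (s \<noteq> 0 \<or> t \<noteq> 0) \<and> s *\<^sub>R a + t *\<^sub>R b = 0)"
proof
  assume d: "det2 a b = 0"
  show "\<exists>s t. (s \<noteq> 0 \<or> t \<noteq> 0) \<and> s *\<^sub>R a + t *\<^sub>R b = 0"
  proof (cases "a = 0")
    case True
    then show ?thesis by (intro exI[of _ 1] exI[of _ 0]) simp
  next
    case False
    then consider "a $ 1 \<noteq> 0" | "a $ 2 \<noteq> 0" by (auto simp: vec_eq_iff forall_2)
    then show ?thesis
    proof cases
      case 1
      then show ?thesis using d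
        by (intro exI[of _ "b $ 1"] exI[of _ "- a $ 1"])
          (auto simp: vec_eq_iff forall_2 det2_def algebra_simps)
    next
      case 2
      then show ?thesis using d
        by (intro exI[of _ "b $ 2"] exI[of _ "- a $ 2"])
          (auto simp: vec_eq_iff forall_2 det2_def algebra_simps)
    qed
  qed
next
  assume "\<exists>s t. (s \<noteq> 0 \<or> t \<noteq> 0) \<and> s *\<^sub>R a + t *\<^sub>R b = 0"
  then obtain s t where st: "s \<noteq> 0 \<or> t \<noteq> 0" "s *\<^sub>R a + t *\<^sub>R b = 0" by blast
  then have c: "s * a $ 1 + t * b $ 1 = 0" "s * a $ 2 + t * b $ 2 = 0"
    by (simp_all add: vec_eq_iff forall_2)
  have "s * det2 a b = 0" "t * det2 a b = 0"
    using c unfolding det2_def by algebra+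
  then show "det2 a b = 0" using st(1) by auto
qed

lemma det2_basis:
  assumes "det2 a b \<noteq> 0"
  obtains s t where "x = s *\<^sub>R a + t *\<^sub>R b"
proof
  \<comment> \<open>Cramer's rule.\<close>
  show "x = (det2 x b / det2 a b) *\<^sub>R a + (det2 a x / det2 a b) *\<^sub>R b"
    using assms by (simp add: vec_eq_iff forall_2 field_simps) (simp add: det2_def algebra_simps)
qed

text \<open>\<open>e\<close> and \<open>f\<close> are the columns of the inverse of the matrix with
  rows \<open>a\<close> and \<open>b\<close>. The second expansion is the transpose of the first; it
  makes the relation between the two pairs symmetric.\<close>

lemma det2_dual_basis:
  assumes "det2 a b \<noteq> 0"
  obtains e f where "a \<bullet> e = 1" "a \<bullet> f = 0" "b \<bullet> e = 0" "b \<bullet> f = 1" "det2 e f \<noteq> 0"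
    "\<And>x. x = (a \<bullet> x) *\<^sub>R e + (b \<bullet> x) *\<^sub>R f" "\<And>x. x = (e \<bullet> x) *\<^sub>R a + (f \<bullet> x) *\<^sub>R b"
proof -
  define e :: plane where "e = (1 / det2 a b) *\<^sub>R vector [b $ 2, - b $ 1]"
  define f :: plane where "f = (1 / det2 a b) *\<^sub>R vector [- a $ 2, a $ 1]"
  have 1: "a \<bullet> e = 1" "a \<bullet> f = 0" "b \<bullet> e = 0" "b \<bullet> f = 1"
    using assms by (simp_all add: e_def f_def inner_vec_def sum_2 field_simps)
      (simp_all add: det2_def)
  have 2: "x = (a \<bullet> x) *\<^sub>R e + (b \<bullet> x) *\<^sub>R f" for x
    using assms by (simp add: e_def f_def inner_vec_def sum_2 vec_eq_iff forall_2 field_simps)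
      (simp add: det2_def algebra_simps)
  have 3: "x = (e \<bullet> x) *\<^sub>R a + (f \<bullet> x) *\<^sub>R b" for x
    using assms by (simp add: e_def f_def inner_vec_def sum_2 vec_eq_iff forall_2 field_simps)
      (simp add: det2_def algebra_simps)
  have "det2 e f \<noteq> 0"
  proof
    assume "det2 e f = 0"
    then obtain s t where st: "s \<noteq> 0 \<or> t \<noteq> 0" "s *\<^sub>R e + t *\<^sub>R f = 0"
      unfolding det2_eq_0_iff by blast
    have "a \<bullet> (s *\<^sub>R e + t *\<^sub>R f) = s" "b \<bullet> (s *\<^sub>R e + t *\<^sub>R f) = t"
      by (simp_all add: inner_add_right 1)
    then show False using st by simp
  qed
  then show ?thesis using that 1 2 3 by blast
qed

text \<open>Supplies the points approaching a corner \<open>(s, t)\<close> strictly from below that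
  \<open>monotone_in_three_directions\<close> asks for.\<close>

lemma dense_coordinates:
  assumes "det2 a b \<noteq> 0" "closure V = UNIV" "0 < \<delta>"
  shows "\<exists>v\<in>V. s - \<delta> < a \<bullet> v \<and> a \<bullet> v < s \<and> t - \<delta> < b \<bullet> v \<and> b \<bullet> v < t"
proof -
  obtain e f where ef: "a \<bullet> e = 1" "a \<bullet> f = 0" "b \<bullet> e = 0" "b \<bullet> f = 1"
    using det2_dual_basis[OF assms(1)] by metis
  let ?S = "{v. s - \<delta> < a \<bullet> v \<and> a \<bullet> v < s \<and> t - \<delta> < b \<bullet> v \<and> b \<bullet> v < t}"
  have "open ?S"
    by (intro open_Collect_conj open_Collect_less continuous_intros)
  moreover have "(s - \<delta> / 2) *\<^sub>R e + (t - \<delta> / 2) *\<^sub>R f \<in> ?S"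
    using assms(3) by (simp add: inner_add_right ef)
  ultimately have "?S \<inter> V \<noteq> {}"
    using open_Int_closure_eq_empty[of ?S V] assms(2) by auto
  then show ?thesis by blast
qed

text \<open>A nonzero functional is unbounded along the multiples of \<open>a\<close>, and replacing
  a multiple and 0 by points of \<open>V\<close> within distance 1 changes its values by at most
  \<open>norm a\<close> each.\<close>

lemma dense_bounded_functional_eq_0:
  assumes "closure V = UNIV" "\<And>u v. u \<in> V \<Longrightarrow> v \<in> V \<Longrightarrow> \<bar>a \<bullet> (u - v)\<bar> \<le> M"
  shows "a = 0"
proof (rule ccontr)
  assume a: "a \<noteq> 0"
  have "\<exists>v\<in>V. dist v x < 1" for x
    using closure_approachable[of x V] assms(1) by (metis UNIV_I zero_less_one)
  then obtain w where w: "\<And>x. w x \<in> V" "\<And>x. dist (w x) x < 1" by metis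
  have *: "real n * (a \<bullet> a) \<le> M + 2 * norm a" for n
  proof -
    let ?x = "real n *\<^sub>R a"
    have err: "\<bar>a \<bullet> (w x - x)\<bar> \<le> norm a" for x
    proof -
      have "\<bar>a \<bullet> (w x - x)\<bar> \<le> norm a * norm (w x - x)" by (rule Cauchy_Schwarz_ineq2)
      also have "\<dots> \<le> norm a * 1"
        using w(2)[of x] by (intro mult_left_mono) (auto simp: dist_norm)
      finally show ?thesis by simp
    qed
    show ?thesis
      using assms(2)[OF w(1)[of ?x] w(1)[of 0]] err[of ?x] err[of 0]
      by (simp add: inner_diff_right abs_le_iff)
  qed
  have "0 < a \<bullet> a" using a by simp
  then obtain n where "M + 2 * norm a < real n * (a \<bullet> a)"
    using ex_less_of_nat_mult by blast
  with * show False by (meson not_le)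
qed

section \<open>Bounded deviation, monotone coordinates and an additive functional equation\<close>

lemma eq_0_if_multiples_bounded:
  fixes c :: real
  assumes "\<And>n::nat. real n * \<bar>c\<bar> \<le> M"
  shows "c = 0"
proof (rule ccontr)
  assume "c \<noteq> 0"
  then obtain n where "M < real n * \<bar>c\<bar>"
    using ex_less_of_nat_mult[of "\<bar>c\<bar>" M] by auto
  with assms[of n] show False by simp
qed

text \<open>\<open>h\<close> is the left limit of \<open>X\<close>, a supremum over points with
  strictly smaller \<open>x\<close>. \<open>X\<close> need not be a function of \<open>x\<close>,
  since points with equal \<open>x\<close> are not compared; \<open>h\<close> is a genuine function
  on the reals that stays close to the identity.\<close>

lemma monotone_left_limit:
  fixes x X :: "'a \<Rightarrow> real"
  assumes mono: "\<And>u v. u \<in> V \<Longrightarrow> v \<in> V \<Longrightarrow> x u < x v \<Longrightarrow> X u \<le> X v"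
    and bounded: "\<And>v. v \<in> V \<Longrightarrow> \<bar>X v - x v\<bar> \<le> C"
    and dense: "\<And>s \<delta>. 0 < \<delta> \<Longrightarrow> \<exists>v\<in>V. s - \<delta> < x v \<and> x v < s"
  obtains h where "\<And>v s. v \<in> V \<Longrightarrow> x v < s \<Longrightarrow> X v \<le> h s"
    "\<And>s e. 0 < e \<Longrightarrow> \<exists>v\<in>V. x v < s \<and> h s - e < X v"
    "\<And>v. v \<in> V \<Longrightarrow> h (x v) \<le> X v"
    "\<And>s. \<bar>h s - s\<bar> \<le> C"
proof
  define S where "S s = X ` {v \<in> V. x v < s}" for s
  define h where "h s = Sup (S s)" for s
  have ne: "S s \<noteq> {}" for s using dense[of 1 s] by (auto simp: S_def)
  have le: "y \<le> s + C" if "y \<in> S s" for y s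
    using that bounded by (force simp: S_def abs_le_iff)
  then have bdd: "bdd_above (S s)" for s by (rule bdd_aboveI)
  show 1: "X v \<le> h s" if "v \<in> V" "x v < s" for v s
    unfolding h_def by (rule cSup_upper[OF _ bdd]) (use that in \<open>auto simp: S_def\<close>)
  show "\<exists>v\<in>V. x v < s \<and> h s - e < X v" if "0 < e" for s e
    using less_cSup_iff[OF ne bdd, of "h s - e" s] that by (auto simp: h_def S_def)
  show "h (x v) \<le> X v" if "v \<in> V" for v
    unfolding h_def by (rule cSup_least[OF ne]) (use that mono in \<open>auto simp: S_def\<close>)
  show "\<bar>h s - s\<bar> \<le> C" for s
  proof -
    have "h s \<le> s + C" unfolding h_def by (rule cSup_least[OF ne le])
    moreover have "s \<le> h s + C + e" if e: "0 < e" for e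
    proof -
      obtain v where v: "v \<in> V" "s - e < x v" "x v < s" using dense[OF e] by blast
      then show ?thesis using 1[OF v(1,3)] bounded[OF v(1)] by (simp add: abs_le_iff)
    qed
    then have "s \<le> h s + C" by (rule field_le_epsilon)
    ultimately show ?thesis by (simp add: abs_le_iff)
  qed
qed

text \<open>The one-sided limits of the three monotone coordinates satisfy
  \<open>h s + k t = l (s + t)\<close> for all \<open>s\<close>, \<open>t\<close>, discontinuities included, because a quadrant
  with corner \<open>(s, t)\<close> lies in the half-plane below \<open>s + t\<close>.\<close>

lemma monotone_in_three_directions:
  fixes x y X Y :: "'a \<Rightarrow> real"
  assumes mx: "\<And>u v. u \<in> V \<Longrightarrow> v \<in> V \<Longrightarrow> x u < x v \<Longrightarrow> X u \<le> X v"
    and my: "\<And>u v. u \<in> V \<Longrightarrow> v \<in> V \<Longrightarrow> y u < y v \<Longrightarrow> Y u \<le> Y v"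
    and mz: "\<And>u v. u \<in> V \<Longrightarrow> v \<in> V \<Longrightarrow> x u + y u < x v + y v \<Longrightarrow> X u + Y u \<le> X v + Y v"
    and bx: "\<And>v. v \<in> V \<Longrightarrow> \<bar>X v - x v\<bar> \<le> C"
    and "by": "\<And>v. v \<in> V \<Longrightarrow> \<bar>Y v - y v\<bar> \<le> C"
    and dense: "\<And>s t \<delta>. 0 < \<delta> \<Longrightarrow> \<exists>v\<in>V. s - \<delta> < x v \<and> x v < s \<and> t - \<delta> < y v \<and> y v < t"
  shows "\<exists>c. \<forall>v\<in>V. X v = x v + c"
proof -
  have dx: "\<exists>v\<in>V. s - \<delta> < x v \<and> x v < s" and dy: "\<exists>v\<in>V. s - \<delta> < y v \<and> y v < s"
    if "0 < \<delta>" for s \<delta>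
    using dense[OF that, of s s] by blast+
  have dz: "\<exists>v\<in>V. s - \<delta> < x v + y v \<and> x v + y v < s" if "0 < \<delta>" for s \<delta>
  proof -
    have "0 < \<delta> / 2" using that by simp
    then obtain v where "v \<in> V" "s - \<delta> / 2 < x v" "x v < s" "0 - \<delta> / 2 < y v" "y v < 0"
      using dense by blast
    then show ?thesis by (intro bexI[of _ v]) auto
  qed
  have bz: "\<bar>(X v + Y v) - (x v + y v)\<bar> \<le> 2 * C" if "v \<in> V" for v
    using bx[OF that] "by"[OF that] by (simp add: abs_le_iff)
  obtain h where h: "\<And>v s. v \<in> V \<Longrightarrow> x v < s \<Longrightarrow> X v \<le> h s"
    "\<And>s e. 0 < e \<Longrightarrow> \<exists>v\<in>V. x v < s \<and> h s - e < X v"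
    "\<And>v. v \<in> V \<Longrightarrow> h (x v) \<le> X v" "\<And>s. \<bar>h s - s\<bar> \<le> C"
    by (rule monotone_left_limit[of V x X C, OF mx bx dx]) blast+
  obtain k where k: "\<And>v s. v \<in> V \<Longrightarrow> y v < s \<Longrightarrow> Y v \<le> k s"
    "\<And>s e. 0 < e \<Longrightarrow> \<exists>v\<in>V. y v < s \<and> k s - e < Y v"
    by (rule monotone_left_limit[of V y Y C, OF my "by" dy]) blast+
  obtain l where l: "\<And>v s. v \<in> V \<Longrightarrow> x v + y v < s \<Longrightarrow> X v + Y v \<le> l s"
    "\<And>s e. 0 < e \<Longrightarrow> \<exists>v\<in>V. x v + y v < s \<and> l s - e < X v + Y v"
    by (rule monotone_left_limit[of V "\<lambda>v. x v + y v" "\<lambda>v. X v + Y v" "2 * C", OF mz bz dz]) blast+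
  have eq: "h s + k t = l (s + t)" for s t
  proof -
    have "\<bar>h s + k t - l (s + t)\<bar> \<le> 0 + e" if e: "0 < e" for e
    proof -
      have e2: "0 < e / 2" using e by simp
      obtain v1 where v1: "v1 \<in> V" "x v1 < s" "h s - e / 2 < X v1" using h(2)[OF e2] by blast
      obtain v2 where v2: "v2 \<in> V" "y v2 < t" "k t - e / 2 < Y v2" using k(2)[OF e2] by blast
      obtain v3 where v3: "v3 \<in> V" "x v3 + y v3 < s + t" "l (s + t) - e / 2 < X v3 + Y v3"
        using l(2)[OF e2] by blast
      \<comment> \<open>With this \<delta>, a point within \<delta> below the corner in both
        coordinates exceeds \<open>v1\<close> in \<open>x\<close>, \<open>v2\<close> in
        \<open>y\<close> and \<open>v3\<close> in the sum at once. The sum can fall short of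
        \<open>s + t\<close> by up to \<open>2 * \<delta>\<close>, hence the division by 2.\<close>
      define \<delta> where "\<delta> = min (min (s - x v1) (t - y v2)) ((s + t - (x v3 + y v3)) / 2)"
      have \<delta>: "0 < \<delta>" "\<delta> \<le> s - x v1" "\<delta> \<le> t - y v2" "2 * \<delta> \<le> s + t - (x v3 + y v3)"
        using v1(2) v2(2) v3(2) by (auto simp: \<delta>_def min_def)
      obtain v where v: "v \<in> V" "s - \<delta> < x v" "x v < s" "t - \<delta> < y v" "y v < t"
        using dense[OF \<delta>(1)] by blast
      have "X v1 \<le> X v" "Y v2 \<le> Y v" "X v3 + Y v3 \<le> X v + Y v"
        by (rule mx[OF v1(1) v(1)] my[OF v2(1) v(1)] mz[OF v3(1) v(1)]; use \<delta> v in linarith)+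
      moreover have "X v \<le> h s" "Y v \<le> k t" "X v + Y v \<le> l (s + t)"
        using h(1)[OF v(1,3)] k(1)[OF v(1,5)] l(1)[OF v(1), of "s + t"] v by auto
      ultimately show ?thesis using v1(3) v2(3) v3(3) by (simp add: abs_le_iff)
    qed
    then have "\<bar>h s + k t - l (s + t)\<bar> \<le> 0" by (rule field_le_epsilon)
    then show ?thesis by simp
  qed
  \<comment> \<open>Pexider's equation reduces to Cauchy's: the values \<open>k 0\<close> and
    \<open>k t\<close> are eliminated by taking one of the arguments to be 0.\<close>
  have add: "h (s + t) = h s + h t - h 0" for s t
    using eq[of "s + t" 0] eq[of s t] eq[of 0 t] eq[of t 0] by simp
  have mult: "h (real n * s) - h 0 = real n * (h s - h 0)" for n s
    by (induction n) (simp_all add: distrib_right add)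
  \<comment> \<open>The additive function \<open>h - h 0\<close> has slope 1: a deviation at
    \<open>s\<close> would grow linearly along the multiples of \<open>s\<close>, but
    \<open>h\<close> stays within \<open>C\<close> of the identity.\<close>
  have lin: "h s = s + h 0" for s
  proof -
    have "real n * \<bar>h s - h 0 - s\<bar> \<le> 2 * C" for n
    proof -
      have "real n * \<bar>h s - h 0 - s\<bar> = \<bar>h (real n * s) - h 0 - real n * s\<bar>"
        unfolding mult by (simp add: abs_mult flip: right_diff_distrib)
      then show ?thesis using h(4)[of "real n * s"] h(4)[of 0] by linarith
    qed
    then have "h s - h 0 - s = 0" by (rule eq_0_if_multiples_bounded)
    then show ?thesis by simp
  qed
  have "X v = x v + h 0" if v: "v \<in> V" for v
  \<comment> \<open>\<open>X v\<close> lies between \<open>h (x v)\<close> and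
    \<open>h (x v + e)\<close>, and the explicit form of \<open>h\<close> leaves no room for a
    jump.\<close>
  proof (rule antisym)
    show "X v \<le> x v + h 0"
    proof (rule field_le_epsilon)
      fix e :: real assume "0 < e"
      then show "X v \<le> x v + h 0 + e" using h(1)[OF v, of "x v + e"] lin[of "x v + e"] by simp
    qed
    show "x v + h 0 \<le> X v" using h(3)[OF v] lin[of "x v"] by simp
  qed
  then show ?thesis by blast
qed

section \<open>Norms on the plane and their supporting functionals\<close>

locale plane_norm =
  fixes N :: "plane \<Rightarrow> real"
  assumes is_norm: "is_norm N"
begin

lemma nonneg [simp]: "0 \<le> N x"
  and eq_0_iff [simp]: "N x = 0 \<longleftrightarrow> x = 0"
  and scale: "N (c *\<^sub>R x) = \<bar>c\<bar> * N x"
  and triangle: "N (x + y) \<le> N x + N y"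
  using is_norm by (auto simp: is_norm_def)

lemma zero [simp]: "N 0 = 0"
  by simp

lemma pos: "x \<noteq> 0 \<Longrightarrow> 0 < N x"
  using nonneg[of x] eq_0_iff[of x] by linarith

lemma minus [simp]: "N (- x) = N x"
  using scale[of "-1" x] by simp

lemma minus_commute: "N (x - y) = N (y - x)"
  using minus[of "x - y"] by simp

lemma diff_le: "N (x - y) \<le> N x + N y"
  using triangle[of x "- y"] by simp

lemma triangle_sub: "N x \<le> N y + N (x - y)"
  using triangle[of y "x - y"] by simp

lemma le_norm: "\<exists>K>0. \<forall>x. N x \<le> K * norm x"
proof -
  let ?K = "N (axis 1 1) + N (axis 2 1) + 1"
  have "N x \<le> ?K * norm x" for x :: plane
  proof -
    have x: "x = (x $ 1) *\<^sub>R axis 1 1 + (x $ 2) *\<^sub>R axis 2 1"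
      by (simp add: vec_eq_iff forall_2 axis_def)
    have "N x \<le> \<bar>x $ 1\<bar> * N (axis 1 1) + \<bar>x $ 2\<bar> * N (axis 2 1)"
      by (subst x, rule order_trans[OF triangle]) (simp add: scale)
    also have "\<dots> \<le> norm x * N (axis 1 1) + norm x * N (axis 2 1)"
      by (intro add_mono mult_right_mono component_le_norm_cart) auto
    also have "\<dots> \<le> ?K * norm x"
      by (simp add: algebra_simps)
    finally show ?thesis .
  qed
  moreover have "0 < ?K"
    using nonneg[of "axis 1 1"] nonneg[of "axis 2 1"] by linarith
  ultimately show ?thesis by blast
qed

lemma dense:
  assumes "closure V = UNIV" "0 < e"
  obtains v where "v \<in> V" "N (v - x) < e"
proof -
  obtain K where K: "0 < K" "\<And>x. N x \<le> K * norm x" using le_norm by blast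
  have "x \<in> closure V" using assms by simp
  then obtain v where v: "v \<in> V" "dist v x < e / K"
    using K(1) assms(2) by (meson closure_approachable divide_pos_pos)
  have "N (v - x) \<le> K * norm (v - x)" by (rule K)
  also have "\<dots> < e" using v K(1) by (simp add: dist_norm field_simps)
  finally show ?thesis using that v by blast
qed

text \<open>The Hahn-Banach theorem in the plane. At a point \<open>q\<close> of norm 1, separating
  0 from the open unit ball around \<open>q\<close> yields a functional whose values on the open
  unit ball around 0 do not exceed its value at \<open>q\<close>; the rest is normalization and
  homogeneity.\<close>

lemma support: "\<exists>a. a \<bullet> p = N p \<and> (\<forall>z. a \<bullet> z \<le> N z)"
proof (cases "p \<noteq> 0")
  case True
  define q where "q = (1 / N p) *\<^sub>R p"
  have Nq: "N q = 1" using pos[OF True] True by (simp add: q_def scale)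
  let ?S = "{x. N (q - x) < 1}"
  have "convex ?S"
  proof (rule convexI)
    fix x y and s t :: real
    assume xy: "x \<in> ?S" "y \<in> ?S" and st: "0 \<le> s" "0 \<le> t" "s + t = 1"
    have "q - (s *\<^sub>R x + t *\<^sub>R y) = s *\<^sub>R (q - x) + t *\<^sub>R (q - y)"
      using st(3) by (simp add: algebra_simps flip: scaleR_add_left)
    then have "N (q - (s *\<^sub>R x + t *\<^sub>R y)) \<le> s * N (q - x) + t * N (q - y)"
      using triangle[of "s *\<^sub>R (q - x)" "t *\<^sub>R (q - y)"] st by (simp add: scale)
    also have "\<dots> < 1"
      using convex_bound_lt[of "N (q - x)" 1 "N (q - y)" s t] xy st by simp
    finally show "s *\<^sub>R x + t *\<^sub>R y \<in> ?S" by simp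
  qed
  moreover have "0 \<notin> ?S" using Nq by simp
  ultimately obtain a where a: "a \<noteq> 0" "\<And>x. x \<in> ?S \<Longrightarrow> 0 \<le> a \<bullet> x"
    using separating_hyperplane_set_0[of ?S] by (auto simp: inner_commute)
  have le: "a \<bullet> x \<le> a \<bullet> q" if "N x < 1" for x
    using a(2)[of "q - x"] that by (simp add: inner_diff_right)
  \<comment> \<open>The multiple of \<open>a\<close> with norm 1/2 lies in the open ball and
    \<open>a\<close> is positive on it, so \<open>a \<bullet> q\<close> is positive and can be
    normalized to 1.\<close>
  define e where "e = 1 / (2 * N a)"
  have "N (e *\<^sub>R a) < 1" "0 < e" using pos[OF a(1)] by (simp_all add: e_def scale)
  then have "0 < e * (a \<bullet> a)" "e * (a \<bullet> a) \<le> a \<bullet> q"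
    using le[of "e *\<^sub>R a"] a(1) by auto
  then have aq: "0 < a \<bullet> q" by linarith
  define b where "b = (1 / (a \<bullet> q)) *\<^sub>R a"
  have le1: "b \<bullet> x \<le> 1" if "N x < 1" for x
    using le[OF that] aq by (simp add: b_def)
  have "b \<bullet> z \<le> N z" for z
  proof (rule field_le_epsilon)
    fix e :: real assume e: "0 < e"
    have r: "0 < N z + e" using e nonneg[of z] by linarith
    have "N ((1 / (N z + e)) *\<^sub>R z) < 1"
      using r e by (simp add: scale)
    from le1[OF this] show "b \<bullet> z \<le> N z + e"
      using r by (simp add: field_simps)
  qed
  moreover have "b \<bullet> p = N p"
  proof -
    have "p = N p *\<^sub>R q" using pos[OF True] True by (simp add: q_def)
    then have "b \<bullet> p = N p * (b \<bullet> q)" by (metis inner_scaleR_right)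
    then show ?thesis using aq by (simp add: b_def)
  qed
  ultimately show ?thesis by blast
next
  case False
  then show ?thesis by (intro exI[of _ 0]) simp
qed

section \<open>Gradients and the norm far away from the origin\<close>

text \<open>Differentiability at \<open>p\<close> with derivative \<open>a\<close>, stated without
  limits. The support condition bounds all difference quotients from below; by convexity they
  increase with the step, so a single \<epsilon> for each \<eta> bounds all shorter steps from
  above.\<close>

definition gradient_at :: "plane \<Rightarrow> plane \<Rightarrow> bool" where
  "gradient_at p a \<longleftrightarrow> p \<noteq> 0 \<and> a \<bullet> p = N p \<and> (\<forall>z. a \<bullet> z \<le> N z) \<and>
     (\<forall>z. \<forall>\<eta>>0. \<exists>\<epsilon>>0. N (p + \<epsilon> *\<^sub>R z) \<le> N p + \<epsilon> * (a \<bullet> z + \<eta>))"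

lemma gradient_at_abs_le:
  assumes "gradient_at p a"
  shows "\<bar>a \<bullet> z\<bar> \<le> N z"
proof -
  have "a \<bullet> z \<le> N z" "a \<bullet> (- z) \<le> N (- z)"
    using assms unfolding gradient_at_def by blast+
  then show ?thesis by (simp add: abs_le_iff)
qed

text \<open>Convexity along a line, in the form that carries a slope bound for a long step over to a
  step of length 1.\<close>

lemma segment_slope:
  assumes "1 \<le> t"
  shows "t * (N (x + z) - N x) \<le> N (x + t *\<^sub>R z) - N x"
proof -
  have "t *\<^sub>R (x + z) = (t - 1) *\<^sub>R x + (x + t *\<^sub>R z)"
    by (simp add: algebra_simps)
  then have "t * N (x + z) \<le> (t - 1) * N x + N (x + t *\<^sub>R z)"
    using triangle[of "(t - 1) *\<^sub>R x" "x + t *\<^sub>R z"] scale[of t "x + z"] scale[of "t - 1" x] assms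
    by simp
  then show ?thesis by (simp add: algebra_simps)
qed

text \<open>Scaling by \<open>R\<close> turns the small step \<epsilon> at \<open>p\<close> into a
  step of length \<open>R * \<epsilon>\<close> at \<open>R p\<close>. The displacement
  \<open>u\<close> costs only \<open>2 * C\<close> there, which is negligible against
  \<open>R * \<epsilon> * \<eta>\<close>, and \<open>segment_slope\<close> returns to the step
  \<open>z\<close>.\<close>

lemma far_increment_le:
  assumes "gradient_at p a" "0 < \<eta>"
  shows "\<exists>R0. \<forall>R\<ge>R0. \<forall>u. N u \<le> C \<longrightarrow> N (R *\<^sub>R p + u + z) - N (R *\<^sub>R p + u) \<le> a \<bullet> z + \<eta>"
proof -
  have "0 < \<eta> / 2" using assms by simp
  then obtain \<epsilon> where e: "0 < \<epsilon>" "N (p + \<epsilon> *\<^sub>R z) \<le> N p + \<epsilon> * (a \<bullet> z + \<eta> / 2)"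
    using assms(1) unfolding gradient_at_def by blast
  \<comment> \<open>The three bounds make \<open>R\<close> positive, make
    \<open>segment_slope\<close> applicable with \<open>t = R * \<epsilon>\<close>, and absorb
    \<open>2 * C\<close> into the second half of \<eta>.\<close>
  define R0 where "R0 = max 1 (max (1 / \<epsilon>) (4 * C / (\<epsilon> * \<eta>)))"
  have "N (R *\<^sub>R p + u + z) - N (R *\<^sub>R p + u) \<le> a \<bullet> z + \<eta>" if R: "R0 \<le> R" and u: "N u \<le> C" for R u
  proof -
    have R1: "0 < R" "1 \<le> R * \<epsilon>" "4 * C \<le> R * (\<epsilon> * \<eta>)"
      using R e(1) assms(2) by (auto simp: R0_def field_simps)
    let ?x = "R *\<^sub>R p + u"
    have "N (?x + (R * \<epsilon>) *\<^sub>R z) \<le> N (R *\<^sub>R (p + \<epsilon> *\<^sub>R z)) + N u"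
      using triangle[of "R *\<^sub>R (p + \<epsilon> *\<^sub>R z)" u] by (simp add: algebra_simps)
    also have "\<dots> \<le> R * (N p + \<epsilon> * (a \<bullet> z + \<eta> / 2)) + C"
      using e(2) u R1(1) by (auto simp: scale intro!: add_mono)
    finally have up: "N (?x + (R * \<epsilon>) *\<^sub>R z) \<le> R * (N p + \<epsilon> * (a \<bullet> z + \<eta> / 2)) + C" .
    have "R * N p \<le> N ?x + C"
      using triangle_sub[of "R *\<^sub>R p" ?x] u R1(1) by (simp add: scale)
    then have "R * \<epsilon> * (N (?x + z) - N ?x) \<le> R * \<epsilon> * (a \<bullet> z + \<eta> / 2) + 2 * C"
      using segment_slope[OF R1(2), of ?x z] up by (simp add: algebra_simps)
    also have "\<dots> \<le> R * \<epsilon> * (a \<bullet> z + \<eta>)"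
      using R1(3) by (simp add: algebra_simps)
    finally show ?thesis using R1(1) e(1) by simp
  qed
  then show ?thesis by blast
qed

lemma far_increment:
  assumes "gradient_at p a" "0 < \<eta>"
  shows "\<exists>R0. \<forall>R\<ge>R0. \<forall>u. N u \<le> C \<longrightarrow> \<bar>N (R *\<^sub>R p + u + z) - N (R *\<^sub>R p + u) - a \<bullet> z\<bar> \<le> \<eta>"
proof -
  obtain R1 where R1: "\<And>R u. R1 \<le> R \<Longrightarrow> N u \<le> C \<Longrightarrow>
      N (R *\<^sub>R p + u + z) - N (R *\<^sub>R p + u) \<le> a \<bullet> z + \<eta>"
    using far_increment_le[OF assms] by metis
  \<comment> \<open>The lower bound is the upper bound for the step \<open>- z\<close> taken back
    from \<open>u + z\<close>, hence the enlarged radius.\<close>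
  obtain R2 where R2: "\<And>R u. R2 \<le> R \<Longrightarrow> N u \<le> C + N z \<Longrightarrow>
      N (R *\<^sub>R p + u + - z) - N (R *\<^sub>R p + u) \<le> a \<bullet> (- z) + \<eta>"
    using far_increment_le[OF assms] by metis
  have "\<bar>N (R *\<^sub>R p + u + z) - N (R *\<^sub>R p + u) - a \<bullet> z\<bar> \<le> \<eta>"
    if "max R1 R2 \<le> R" "N u \<le> C" for R u
    using R1[of R u] R2[of R "u + z"] triangle[of u z] that by (simp add: abs_le_iff add.assoc)
  then show ?thesis by blast
qed

text \<open>The case \<open>u = 0\<close>: the Busemann function of the ray through \<open>p\<close>
  is linear.\<close>

lemma far_norm:
  assumes "gradient_at p a" "0 < \<eta>"
  shows "\<exists>R0. \<forall>R\<ge>R0. \<bar>N (R *\<^sub>R p + z) - R * N p - a \<bullet> z\<bar> \<le> \<eta>"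
proof -
  obtain R0 where "\<And>R. R0 \<le> R \<Longrightarrow> \<bar>N (R *\<^sub>R p + 0 + z) - N (R *\<^sub>R p + 0) - a \<bullet> z\<bar> \<le> \<eta>"
    using far_increment[OF assms, of 0 z] by (metis order_refl zero)
  then have "\<bar>N (R *\<^sub>R p + z) - R * N p - a \<bullet> z\<bar> \<le> \<eta>" if "max 0 R0 \<le> R" for R
    using that by (metis abs_of_nonneg add.right_neutral max.bounded_iff scale)
  then show ?thesis by blast
qed

text \<open>\<open>N\<close> is examined on the line through \<open>x\<close> perpendicular to
  \<open>x\<close>, which misses the origin. A monotone slope has only countably many
  discontinuities, so a good point occurs arbitrarily close to \<open>x\<close>; homogeneity takes
  care of the radial direction.\<close>

lemma gradient_at_dense:
  assumes "x \<noteq> 0" "0 < e"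
  obtains p a where "gradient_at p a" "N (p - x) < e"
proof -
  define q :: plane where "q = vector [- x $ 2, x $ 1]"
  have det: "det2 (x + t *\<^sub>R q) q \<noteq> 0" for t
  proof -
    have "det2 (x + t *\<^sub>R q) q = (x $ 1)\<^sup>2 + (x $ 2)\<^sup>2"
      by (simp add: det2_def q_def power2_eq_square algebra_simps)
    then show ?thesis using assms(1) by (auto simp: vec_eq_iff forall_2 sum_power2_eq_zero_iff)
  qed
  have q: "q \<noteq> 0" using det[of 0] by (auto simp: det2_def)
  obtain S where S: "\<And>p. S p \<bullet> p = N p" "\<And>p z. S p \<bullet> z \<le> N z"
    using support by metis
  \<comment> \<open>Continuity points of the monotone slope \<open>s\<close> are differentiability points of \<open>N\<close>.\<close>
  define s where "s t = S (x + t *\<^sub>R q) \<bullet> q" for t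
  have N_line: "N (x + u *\<^sub>R q) \<le> N (x + t *\<^sub>R q) + (u - t) * s u" for t u
  proof -
    have "N (x + u *\<^sub>R q) = S (x + u *\<^sub>R q) \<bullet> (x + t *\<^sub>R q) + (u - t) * s u"
      using S(1)[of "x + u *\<^sub>R q"] by (simp add: s_def inner_add_right algebra_simps)
    then show ?thesis using S(2)[of "x + u *\<^sub>R q" "x + t *\<^sub>R q"] by simp
  qed
  have "mono s"
  proof (rule monoI)
    fix t u :: real assume "t \<le> u"
    have "0 \<le> (u - t) * (s u - s t)"
      using N_line[of u t] N_line[of t u] by (simp add: algebra_simps)
    then show "s t \<le> s u" using \<open>t \<le> u\<close>
      by (cases "t = u") (auto simp: zero_le_mult_iff)
  qed
  then have "countable {t. \<not> isCont s t}" by (rule mono_ctble_discont)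
  moreover have "uncountable {0<..<e / N q}"
    using assms(2) pos[OF q] by (simp add: uncountable_open_interval)
  ultimately have "\<not> {0<..<e / N q} \<subseteq> {t. \<not> isCont s t}"
    using countable_subset by blast
  then obtain t where t: "0 < t" "t < e / N q" "isCont s t" by auto
  define p where "p = x + t *\<^sub>R q"
  have "\<exists>\<epsilon>>0. N (p + \<epsilon> *\<^sub>R z) \<le> N p + \<epsilon> * (S p \<bullet> z + \<eta>)" if \<eta>: "0 < \<eta>" for z \<eta>
  proof -
    obtain \<alpha> \<beta> where z: "z = \<alpha> *\<^sub>R p + \<beta> *\<^sub>R q"
      using det2_basis[OF det[of t], of z] unfolding p_def by metis
    have "((\<lambda>\<epsilon>. t + \<epsilon> * \<beta> / (1 + \<epsilon> * \<alpha>)) \<longlongrightarrow> t) (at_right 0)"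
      by (auto intro!: tendsto_eq_intros)
    then have "((\<lambda>\<epsilon>. \<beta> * s (t + \<epsilon> * \<beta> / (1 + \<epsilon> * \<alpha>))) \<longlongrightarrow> \<beta> * s t) (at_right 0)"
      by (intro tendsto_mult_left isCont_tendsto_compose[OF t(3)])
    then have "\<forall>\<^sub>F \<epsilon> in at_right 0. \<beta> * s (t + \<epsilon> * \<beta> / (1 + \<epsilon> * \<alpha>)) < \<beta> * s t + \<eta>"
      using \<eta> by (intro order_tendstoD(2)[where y = "\<beta> * s t"]) auto
    moreover have "((\<lambda>\<epsilon>. 1 + \<epsilon> * \<alpha>) \<longlongrightarrow> 1) (at_right 0)"
      by (auto intro!: tendsto_eq_intros)
    then have "\<forall>\<^sub>F \<epsilon> in at_right 0. 0 < 1 + \<epsilon> * \<alpha>"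
      by (rule order_tendstoD(1)) simp
    moreover have "\<forall>\<^sub>F \<epsilon> in at_right (0::real). 0 < \<epsilon>"
      by (rule eventually_at_right_less)
    ultimately have "\<forall>\<^sub>F \<epsilon> in at_right 0. \<beta> * s (t + \<epsilon> * \<beta> / (1 + \<epsilon> * \<alpha>)) < \<beta> * s t + \<eta> \<and>
        0 < 1 + \<epsilon> * \<alpha> \<and> 0 < \<epsilon>"
      by eventually_elim auto
    then obtain \<epsilon> where \<epsilon>: "\<beta> * s (t + \<epsilon> * \<beta> / (1 + \<epsilon> * \<alpha>)) < \<beta> * s t + \<eta>"
        "0 < 1 + \<epsilon> * \<alpha>" "0 < \<epsilon>"
      using eventually_happens'[OF trivial_limit_at_right_real] by blast
    \<comment> \<open>Up to the positive factor \<open>1 + \<epsilon> * \<alpha>\<close>, the point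
      \<open>p + \<epsilon> *\<^sub>R z\<close> lies on the line again, at parameter
      \<open>t + \<tau>\<close>.\<close>
    define \<tau> where "\<tau> = \<epsilon> * \<beta> / (1 + \<epsilon> * \<alpha>)"
    have \<tau>: "(1 + \<epsilon> * \<alpha>) * \<tau> = \<epsilon> * \<beta>" using \<epsilon>(2) by (simp add: \<tau>_def)
    have "p + \<epsilon> *\<^sub>R z = (1 + \<epsilon> * \<alpha>) *\<^sub>R p + (\<epsilon> * \<beta>) *\<^sub>R q"
      by (simp add: z algebra_simps)
    also have "\<dots> = (1 + \<epsilon> * \<alpha>) *\<^sub>R (x + (t + \<tau>) *\<^sub>R q)"
      unfolding \<tau>[symmetric] by (simp add: p_def algebra_simps)
    finally have "N (p + \<epsilon> *\<^sub>R z) = (1 + \<epsilon> * \<alpha>) * N (x + (t + \<tau>) *\<^sub>R q)"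
      using \<epsilon>(2) by (simp add: scale)
    also have "\<dots> \<le> (1 + \<epsilon> * \<alpha>) * (N p + \<tau> * s (t + \<tau>))"
      using N_line[of "t + \<tau>" t] \<epsilon>(2) by (intro mult_left_mono) (auto simp: p_def)
    also have "\<dots> = (1 + \<epsilon> * \<alpha>) * N p + \<epsilon> * (\<beta> * s (t + \<tau>))"
      unfolding distrib_left by (simp add: \<tau> flip: mult.assoc)
    also have "\<dots> \<le> (1 + \<epsilon> * \<alpha>) * N p + \<epsilon> * (\<beta> * s t + \<eta>)"
      using \<epsilon> by (intro add_left_mono mult_left_mono) (auto simp: \<tau>_def)
    also have "\<dots> = N p + \<epsilon> * (S p \<bullet> z + \<eta>)"
      using S(1)[of p] by (simp add: z inner_add_right s_def p_def[symmetric] algebra_simps)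
    finally show ?thesis using \<epsilon>(3) by blast
  qed
  moreover have "det2 p q \<noteq> 0" using det[of t] by (simp add: p_def)
  then have "p \<noteq> 0" by (auto simp: det2_def)
  ultimately have "gradient_at p (S p)" using S by (simp add: gradient_at_def)
  moreover have "N (p - x) < e" using t pos[OF q] by (simp add: p_def scale field_simps)
  ultimately show ?thesis using that by blast
qed

text \<open>A gradient at \<open>p\<close> attains \<open>N p\<close> and is bounded by
  \<open>N\<close>, so at \<open>x\<close> it misses \<open>N x\<close> by at most
  \<open>2 * N (p - x)\<close>.\<close>

lemma gradient_at_nearly_norming:
  assumes "x \<noteq> 0" "0 < \<eta>"
  obtains p a where "gradient_at p a" "N x \<le> a \<bullet> x + \<eta>"
proof -
  obtain p a where pa: "gradient_at p a" "N (p - x) < \<eta> / 2"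
    using gradient_at_dense[OF assms(1), of "\<eta> / 2"] assms(2) by auto
  have "N x \<le> N p + N (p - x)" using triangle_sub[of x p] by (simp add: minus_commute)
  also have "N p = a \<bullet> x + a \<bullet> (p - x)" using pa(1) by (simp add: gradient_at_def inner_diff_right)
  also have "a \<bullet> (p - x) \<le> N (p - x)" using pa(1) by (simp add: gradient_at_def)
  finally show ?thesis using that[OF pa(1)] pa(2) by simp
qed

text \<open>Every gradient has dual norm 1: testing \<open>b\<close> at the point \<open>p\<close>
  where \<open>a\<close> attains the norm shows that the ratio of \<open>b\<close> to
  \<open>a\<close> is at most 1 in absolute value.\<close>

lemma parallel_gradients:
  assumes "gradient_at p a" "gradient_at q b" "det2 a b = 0"
  shows "\<bar>b \<bullet> x\<bar> \<le> \<bar>a \<bullet> x\<bar>"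
proof -
  have p: "0 < N p" "a \<bullet> p = N p" using assms(1) pos by (auto simp: gradient_at_def)
  obtain s t where st: "s \<noteq> 0 \<or> t \<noteq> 0" "s *\<^sub>R a + t *\<^sub>R b = 0"
    using assms(3) det2_eq_0_iff by blast
  have "t \<noteq> 0"
  proof
    assume "t = 0"
    then have "s *\<^sub>R a = 0" "s \<noteq> 0" using st by auto
    then show False using p by auto
  qed
  moreover have "t *\<^sub>R b = - s *\<^sub>R a" using st(2) by (simp add: add_eq_0_iff2)
  ultimately have b: "b = (- s / t) *\<^sub>R a"
    by (metis divide_inverse inverse_nonzero_iff_nonzero left_inverse mult.commute scaleR_one scaleR_scaleR)
  have "\<bar>s / t\<bar> * N p \<le> 1 * N p"
    using gradient_at_abs_le[OF assms(2), of p] p by (simp add: b abs_mult)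
  then have "\<bar>s / t\<bar> \<le> 1" using p(1) mult_le_cancel_right_pos by blast
  then show ?thesis using mult_right_mono[of "\<bar>s / t\<bar>" 1 "\<bar>a \<bullet> x\<bar>"] by (simp add: b abs_mult)
qed

text \<open>After any first gradient \<open>a\<close>, a gradient nearly norming a vector in the
  kernel of \<open>a\<close> is not parallel to it. A third one nearly norming a point
  \<open>y\<close> where \<open>N\<close> exceeds both is parallel to neither.\<close>

lemma three_gradients:
  assumes "\<And>a b. det2 a b \<noteq> 0 \<Longrightarrow> \<exists>x. N x \<noteq> max \<bar>a \<bullet> x\<bar> \<bar>b \<bullet> x\<bar>"
  obtains p a q b r c where "gradient_at p a" "gradient_at q b" "gradient_at r c"
    "det2 a b \<noteq> 0" "det2 a c \<noteq> 0" "det2 b c \<noteq> 0"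
proof -
  have "(axis 1 1 :: plane) \<noteq> 0" by simp
  then obtain p a where a: "gradient_at p a"
    using gradient_at_nearly_norming zero_less_one by blast
  define x :: plane where "x = vector [- a $ 2, a $ 1]"
  have ax: "a \<bullet> x = 0" by (simp add: x_def inner_vec_def sum_2)
  have "a \<noteq> 0" using a pos by (auto simp: gradient_at_def)
  then have x: "x \<noteq> 0" by (auto simp: x_def vec_eq_iff forall_2)
  obtain q b where b: "gradient_at q b" "N x \<le> b \<bullet> x + N x / 2"
    using gradient_at_nearly_norming[OF x, of "N x / 2"] pos[OF x] by auto
  have ab: "det2 a b \<noteq> 0"
    using parallel_gradients[OF a b(1), of x] ax b(2) pos[OF x] by auto
  obtain y where y: "N y \<noteq> max \<bar>a \<bullet> y\<bar> \<bar>b \<bullet> y\<bar>" using assms[OF ab] by blast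
  define M where "M = max \<bar>a \<bullet> y\<bar> \<bar>b \<bullet> y\<bar>"
  have "M \<le> N y" using gradient_at_abs_le a b(1) by (simp add: M_def)
  then have M: "0 < (N y - M) / 2" using y by (simp add: M_def less_le)
  moreover have "0 \<le> M" by (simp add: M_def le_max_iff_disj)
  ultimately have "y \<noteq> 0" by auto
  from gradient_at_nearly_norming[OF this M]
  obtain r c where c: "gradient_at r c" "N y \<le> c \<bullet> y + (N y - M) / 2" by blast
  then have "M < c \<bullet> y" using M by (simp add: field_simps)
  then have "\<bar>a \<bullet> y\<bar> < \<bar>c \<bullet> y\<bar>" "\<bar>b \<bullet> y\<bar> < \<bar>c \<bullet> y\<bar>" unfolding M_def by linarith+
  then have "det2 a c \<noteq> 0" "det2 b c \<noteq> 0"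
    using parallel_gradients[OF a c(1), of y] parallel_gradients[OF b(1) c(1), of y] by force+
  then show ?thesis using that a b(1) c(1) ab by blast
qed

section \<open>Large-scale linearity of maps with bounded distortion\<close>

text \<open>The functional \<open>b\<close> is a limit of support functionals at \<open>f (n p) - f (- n p)\<close>, up to
  replacing \<open>n p\<close> and \<open>- n p\<close> by nearby points of \<open>V\<close>.\<close>

lemma coarse_gradient:
  assumes grad: "gradient_at p a" and V: "closure V = UNIV"
    and f: "\<And>u v. u \<in> V \<Longrightarrow> v \<in> V \<Longrightarrow> \<bar>N (f u - f v) - N (u - v)\<bar> \<le> 1"
  obtains b where "\<And>u v. u \<in> V \<Longrightarrow> v \<in> V \<Longrightarrow> \<bar>b \<bullet> (f u - f v) - a \<bullet> (u - v)\<bar> \<le> 8"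
proof -
  have "\<exists>v\<in>V. N (v - x) < 1" for x using dense[OF V zero_less_one] by metis
  then obtain w where w: "\<And>x. w x \<in> V" "\<And>x. N (w x - x) < 1" by metis
  define y where "y n = w (real n *\<^sub>R p)" for n
  define y' where "y' n = w (- (real n *\<^sub>R p))" for n
  obtain S where S: "\<And>p. S p \<bullet> p = N p" "\<And>p z. S p \<bullet> z \<le> N z"
    using support by metis
  define b where "b n = S (f (y n) - f (y' n))" for n
  have b: "b n \<bullet> (f (y n) - f (y' n)) = N (f (y n) - f (y' n))" "b n \<bullet> z \<le> N z" for n z
    by (simp_all add: b_def S)
  obtain K where K: "0 < K" "\<And>x. N x \<le> K * norm x" using le_norm by blast
  \<comment> \<open>Testing each functional on its own vector bounds it, so a subsequence
    converges.\<close>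
  have "norm (b n) \<le> K" for n
  proof (cases "b n = 0")
    case False
    have "norm (b n) * norm (b n) \<le> K * norm (b n)"
      using b(2)[of n "b n"] K(2)[of "b n"] by (simp add: dot_square_norm power2_eq_square)
    then show ?thesis using False by simp
  qed (use K in simp)
  then have "\<forall>n. b n \<in> cball 0 K" by simp
  then obtain l \<rho> where l: "strict_mono (\<rho> :: nat \<Rightarrow> nat)" "(b \<circ> \<rho>) \<longlonglongrightarrow> l"
    using compact_cball unfolding compact_def by metis
  have le: "l \<bullet> (f u - f v) \<le> a \<bullet> (u - v) + 8" if uv: "u \<in> V" "v \<in> V" for u v
  proof -
    obtain R1 where R1: "\<And>R. R1 \<le> R \<Longrightarrow> \<bar>N (R *\<^sub>R p + u) - R * N p - a \<bullet> u\<bar> \<le> 1/2"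
      using far_norm[OF grad, of "1/2" u] by auto
    obtain R2 where R2: "\<And>R. R2 \<le> R \<Longrightarrow> \<bar>N (R *\<^sub>R p + - v) - R * N p - a \<bullet> (- v)\<bar> \<le> 1/2"
      using far_norm[OF grad, of "1/2" "- v"] by auto
    \<comment> \<open>The 8 is made up of 3 for three uses of \<open>f\<close>, 4 for replacing
      \<open>n p\<close> and \<open>- n p\<close> by \<open>y n\<close> and \<open>y' n\<close>, and
      twice 1/2 from \<open>far_norm\<close>.\<close>
    have le: "b n \<bullet> (f u - f v) \<le> a \<bullet> (u - v) + 8" if n: "max R1 R2 \<le> real n" for n
    proof -
      have V': "y n \<in> V" "y' n \<in> V" using w by (simp_all add: y_def y'_def)
      have y: "N (y n - real n *\<^sub>R p) < 1" "N (y' n + real n *\<^sub>R p) < 1"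
        using w(2)[of "real n *\<^sub>R p"] w(2)[of "- (real n *\<^sub>R p)"] by (simp_all add: y_def y'_def)
      have "b n \<bullet> (f u - f (y' n)) \<le> N (u - y' n) + 1"
        using b(2)[of n "f u - f (y' n)"] f[OF uv(1) V'(2)] by (simp add: abs_le_iff)
      moreover have "N (u - y' n) \<le> N (real n *\<^sub>R p + u) + 1"
        using diff_le[of "real n *\<^sub>R p + u" "y' n + real n *\<^sub>R p"] y(2) by simp
      moreover have "b n \<bullet> (f (y n) - f v) \<le> N (y n - v) + 1"
        using b(2)[of n "f (y n) - f v"] f[OF V'(1) uv(2)] by (simp add: abs_le_iff)
      moreover have "N (y n - v) \<le> N (real n *\<^sub>R p + - v) + 1"
        using triangle[of "real n *\<^sub>R p + - v" "y n - real n *\<^sub>R p"] y(1) by simp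
      moreover have "N (y n - y' n) - 1 \<le> b n \<bullet> (f (y n) - f (y' n))"
        using b(1)[of n] f[OF V'] by (simp add: abs_le_iff)
      moreover have "2 * (real n * N p) \<le> N (y n - y' n) + 2"
      proof -
        have "(2 * real n) *\<^sub>R p = (y n - y' n) + ((y' n + real n *\<^sub>R p) - (y n - real n *\<^sub>R p))"
          by (simp add: algebra_simps flip: scaleR_2)
        then have "N ((2 * real n) *\<^sub>R p) \<le> N (y n - y' n) +
            (N (y' n + real n *\<^sub>R p) + N (y n - real n *\<^sub>R p))"
          using triangle[of "y n - y' n" "(y' n + real n *\<^sub>R p) - (y n - real n *\<^sub>R p)"]
            diff_le[of "y' n + real n *\<^sub>R p" "y n - real n *\<^sub>R p"] by simp
        then show ?thesis using y by (simp add: scale)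
      qed
      moreover have "\<bar>N (real n *\<^sub>R p + u) - real n * N p - a \<bullet> u\<bar> \<le> 1/2"
        "\<bar>N (real n *\<^sub>R p + - v) - real n * N p - a \<bullet> (- v)\<bar> \<le> 1/2"
        using R1[of "real n"] R2[of "real n"] n by auto
      ultimately show ?thesis
        unfolding inner_diff_right inner_minus_right by linarith
    qed
    have "(\<lambda>n. (b \<circ> \<rho>) n \<bullet> (f u - f v)) \<longlonglongrightarrow> l \<bullet> (f u - f v)"
      by (intro tendsto_inner l tendsto_const)
    moreover have "\<exists>M. \<forall>n\<ge>M. (b \<circ> \<rho>) n \<bullet> (f u - f v) \<le> a \<bullet> (u - v) + 8"
    proof (intro exI allI impI)
      fix n assume "nat \<lceil>max R1 R2\<rceil> \<le> n"
      then have "max R1 R2 \<le> real n" by linarith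
      also have "real n \<le> real (\<rho> n)" using l(1) by (simp add: seq_suble)
      finally show "(b \<circ> \<rho>) n \<bullet> (f u - f v) \<le> a \<bullet> (u - v) + 8" using le by simp
    qed
    ultimately show ?thesis by (rule LIMSEQ_le_const2)
  qed
  have "\<bar>l \<bullet> (f u - f v) - a \<bullet> (u - v)\<bar> \<le> 8" if "u \<in> V" "v \<in> V" for u v
    using le[OF that] le[OF that(2,1)] by (simp add: inner_diff_right abs_le_iff)
  then show ?thesis using that by blast
qed

text \<open>\<open>g\<close> is \<open>L\<close> after \<open>f\<close>, where \<open>L\<close> is
  the linear map that turns the functionals \<open>b1\<close>, \<open>b2\<close> into
  \<open>a1\<close>, \<open>a2\<close>. Then \<open>g\<close> is coarsely the identity, and since
  \<open>f\<close> nearly preserves \<open>N\<close>, homogeneity makes \<open>L\<close> an exact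
  isometry.\<close>

lemma coarse_normalization:
  assumes grad: "gradient_at p1 a1" "gradient_at p2 a2" "det2 a1 a2 \<noteq> 0" and V: "closure V = UNIV"
    and f: "\<And>u v. u \<in> V \<Longrightarrow> v \<in> V \<Longrightarrow> \<bar>N (f u - f v) - N (u - v)\<bar> \<le> 1"
  obtains g C where "\<And>u v. N (g u - g v) = N (f u - f v)"
    "\<And>u v. u \<in> V \<Longrightarrow> v \<in> V \<Longrightarrow> N ((g u - g v) - (u - v)) \<le> C"
proof -
  obtain b1 where b1: "\<And>u v. u \<in> V \<Longrightarrow> v \<in> V \<Longrightarrow> \<bar>b1 \<bullet> (f u - f v) - a1 \<bullet> (u - v)\<bar> \<le> 8"
    using coarse_gradient[OF grad(1) V f] by metis
  obtain b2 where b2: "\<And>u v. u \<in> V \<Longrightarrow> v \<in> V \<Longrightarrow> \<bar>b2 \<bullet> (f u - f v) - a2 \<bullet> (u - v)\<bar> \<le> 8"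
    using coarse_gradient[OF grad(2) V f] by metis
  \<comment> \<open>A dependency between \<open>b1\<close> and \<open>b2\<close> would make the same
    combination of \<open>a1\<close> and \<open>a2\<close> bounded on \<open>V\<close>.\<close>
  have det_b: "det2 b1 b2 \<noteq> 0"
  proof
    assume "det2 b1 b2 = 0"
    then obtain s t where st: "s \<noteq> 0 \<or> t \<noteq> 0" "s *\<^sub>R b1 + t *\<^sub>R b2 = 0"
      unfolding det2_eq_0_iff by blast
    have "\<bar>(s *\<^sub>R a1 + t *\<^sub>R a2) \<bullet> (u - v)\<bar> \<le> \<bar>s\<bar> * 8 + \<bar>t\<bar> * 8" if "u \<in> V" "v \<in> V" for u v
    proof -
      let ?d1 = "b1 \<bullet> (f u - f v) - a1 \<bullet> (u - v)" and ?d2 = "b2 \<bullet> (f u - f v) - a2 \<bullet> (u - v)"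
      have "(s *\<^sub>R b1 + t *\<^sub>R b2) \<bullet> (f u - f v) = 0" by (simp add: st(2))
      then have "(s *\<^sub>R a1 + t *\<^sub>R a2) \<bullet> (u - v) = - (s * ?d1 + t * ?d2)"
        by (simp add: inner_add_left right_diff_distrib)
      also have "\<bar>\<dots>\<bar> \<le> \<bar>s\<bar> * \<bar>?d1\<bar> + \<bar>t\<bar> * \<bar>?d2\<bar>"
        unfolding abs_minus_cancel by (simp add: abs_triangle_ineq flip: abs_mult)
      also have "\<dots> \<le> \<bar>s\<bar> * 8 + \<bar>t\<bar> * 8"
        using b1[OF that] b2[OF that] by (intro add_mono mult_left_mono) auto
      finally show ?thesis .
    qed
    then have "s *\<^sub>R a1 + t *\<^sub>R a2 = 0"
      using dense_bounded_functional_eq_0[OF V] by blast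
    then show False using st(1) grad(3) det2_eq_0_iff by blast
  qed
  obtain e1 e2 where e: "a1 \<bullet> e1 = 1" "a1 \<bullet> e2 = 0" "a2 \<bullet> e1 = 0" "a2 \<bullet> e2 = 1"
    and a_exp: "\<And>x. x = (a1 \<bullet> x) *\<^sub>R e1 + (a2 \<bullet> x) *\<^sub>R e2"
    using det2_dual_basis[OF grad(3)] by metis
  obtain e1' e2' where e': "b1 \<bullet> e1' = 1" "b1 \<bullet> e2' = 0" "b2 \<bullet> e1' = 0" "b2 \<bullet> e2' = 1"
    and b_exp: "\<And>x. x = (b1 \<bullet> x) *\<^sub>R e1' + (b2 \<bullet> x) *\<^sub>R e2'"
    using det2_dual_basis[OF det_b] by metis
  define L where "L y = (b1 \<bullet> y) *\<^sub>R e1 + (b2 \<bullet> y) *\<^sub>R e2" for y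
  have L: "a1 \<bullet> L y = b1 \<bullet> y" "a2 \<bullet> L y = b2 \<bullet> y" for y
    by (simp_all add: L_def inner_add_right e)
  have L_diff: "L x - L y = L (x - y)" for x y
    by (simp add: L_def inner_diff_right algebra_simps)
  have a_bound: "N x \<le> \<bar>a1 \<bullet> x\<bar> * N e1 + \<bar>a2 \<bullet> x\<bar> * N e2" for x
    using triangle[of "(a1 \<bullet> x) *\<^sub>R e1" "(a2 \<bullet> x) *\<^sub>R e2"] by (simp add: scale flip: a_exp)
  have b_bound: "N x \<le> \<bar>b1 \<bullet> x\<bar> * N e1' + \<bar>b2 \<bullet> x\<bar> * N e2'" for x
    using triangle[of "(b1 \<bullet> x) *\<^sub>R e1'" "(b2 \<bullet> x) *\<^sub>R e2'"] by (simp add: scale flip: b_exp)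
  \<comment> \<open>Comparison at large multiples: for a point \<open>u\<close> of \<open>V\<close>
    near \<open>n L y\<close>, the difference \<open>f u - f (w 0)\<close> is within
    \<open>k\<close> of \<open>n y\<close>, so \<open>N y\<close> and \<open>N (L y)\<close> differ
    by O(1/n).\<close>
  have iso: "N (L y) = N y" for y
  proof -
    have "\<exists>v\<in>V. N (v - x) < 1" for x using dense[OF V zero_less_one] by metis
    then obtain w where w: "\<And>x. w x \<in> V" "\<And>x. N (w x - x) < 1" by metis
    \<comment> \<open>In each coordinate, 8 comes from \<open>b1\<close> or \<open>b2\<close>, and
      \<open>1 + N (w 0)\<close> from replacing \<open>n L y\<close> and 0 by \<open>u\<close> and
      \<open>w 0\<close>.\<close>
    define k where "k = (9 + N (w 0)) * (N e1' + N e2')"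
    have "real n * \<bar>N y - N (L y)\<bar> \<le> k + N (w 0) + 2" for n
    proof -
      define u where "u = w (real n *\<^sub>R L y)"
      let ?v = "w 0"
      have u: "u \<in> V" "N (u - real n *\<^sub>R L y) < 1" by (simp_all add: u_def w)
      let ?h = "(f u - f ?v) - real n *\<^sub>R y"
      let ?k = "(u - ?v) - real n *\<^sub>R L y"
      have k: "N ?k \<le> 1 + N ?v"
        using diff_le[of "u - real n *\<^sub>R L y" ?v] u(2) by (simp add: algebra_simps)
      have "b1 \<bullet> ?h = (b1 \<bullet> (f u - f ?v) - a1 \<bullet> (u - ?v)) + a1 \<bullet> ?k"
        "b2 \<bullet> ?h = (b2 \<bullet> (f u - f ?v) - a2 \<bullet> (u - ?v)) + a2 \<bullet> ?k"
        by (simp_all add: inner_diff_right L)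
      moreover note b1[OF u(1) w(1)[of 0]] b2[OF u(1) w(1)[of 0]]
        gradient_at_abs_le[OF grad(1), of ?k] gradient_at_abs_le[OF grad(2), of ?k] k
      ultimately have "\<bar>b1 \<bullet> ?h\<bar> \<le> 9 + N ?v" "\<bar>b2 \<bullet> ?h\<bar> \<le> 9 + N ?v" by linarith+
      then have "\<bar>b1 \<bullet> ?h\<bar> * N e1' + \<bar>b2 \<bullet> ?h\<bar> * N e2' \<le> (9 + N ?v) * N e1' + (9 + N ?v) * N e2'"
        by (intro add_mono mult_right_mono) auto
      then have h: "N ?h \<le> k" using b_bound[of ?h] unfolding k_def distrib_left by linarith
      have "\<bar>N (f u - f ?v) - real n * N y\<bar> \<le> k"
        using h triangle_sub[of "f u - f ?v" "real n *\<^sub>R y"] triangle_sub[of "real n *\<^sub>R y" "f u - f ?v"]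
        by (simp add: scale minus_commute abs_le_iff)
      moreover have "\<bar>N (u - ?v) - real n * N (L y)\<bar> \<le> 1 + N ?v"
        using k triangle_sub[of "u - ?v" "real n *\<^sub>R L y"] triangle_sub[of "real n *\<^sub>R L y" "u - ?v"]
        by (simp add: scale minus_commute abs_le_iff)
      moreover note f[OF u(1) w(1)[of 0]]
      ultimately have "\<bar>real n * N y - real n * N (L y)\<bar> \<le> k + N (w 0) + 2" by linarith
      then show ?thesis by (simp add: abs_mult flip: right_diff_distrib)
    qed
    then have "N y - N (L y) = 0" by (rule eq_0_if_multiples_bounded)
    then show ?thesis by simp
  qed
  show ?thesis
  proof (rule that[of "\<lambda>u. L (f u)" "8 * N e1 + 8 * N e2"])
    show "N (L (f u) - L (f v)) = N (f u - f v)" for u v by (simp add: L_diff iso)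
    fix u v assume uv: "u \<in> V" "v \<in> V"
    let ?h = "(L (f u) - L (f v)) - (u - v)"
    have "\<bar>a1 \<bullet> ?h\<bar> \<le> 8" "\<bar>a2 \<bullet> ?h\<bar> \<le> 8"
      using b1[OF uv] b2[OF uv] by (simp_all add: L_diff inner_diff_right[of _ "L _"] L)
    then have "\<bar>a1 \<bullet> ?h\<bar> * N e1 + \<bar>a2 \<bullet> ?h\<bar> * N e2 \<le> 8 * N e1 + 8 * N e2"
      by (intro add_mono mult_right_mono) auto
    then show "N ?h \<le> 8 * N e1 + 8 * N e2" using a_bound[of ?h] by linarith
  qed
qed

section \<open>Order preservation and rigidity\<close>

text \<open>From a point \<open>w\<close> of \<open>V\<close> near \<open>- R p\<close>, distances
  are nearly \<open>R * N p\<close> plus the value of \<open>a\<close>. For suitable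
  \<open>R\<close> an integer separates the distances to \<open>v\<close> and \<open>v'\<close>, so
  the images are ordered strictly as well; seen from \<open>g w\<close>, a reversed order of
  \<open>a\<close> would contradict this.\<close>

lemma gradient_order_preserved:
  assumes grad: "gradient_at p a" and V: "closure V = UNIV"
    and step: "\<And>u v. u \<in> V \<Longrightarrow> v \<in> V \<Longrightarrow> \<lfloor>N (g u - g v)\<rfloor> = \<lfloor>N (u - v)\<rfloor>"
    and near: "\<And>u v. u \<in> V \<Longrightarrow> v \<in> V \<Longrightarrow> N ((g u - g v) - (u - v)) \<le> C"
    and v: "v \<in> V" "v' \<in> V" "a \<bullet> v < a \<bullet> v'"
  shows "a \<bullet> g v \<le> a \<bullet> g v'"
proof (rule ccontr)
  assume "\<not> a \<bullet> g v \<le> a \<bullet> g v'"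
  define \<delta> where "\<delta> = a \<bullet> v' - a \<bullet> v"
  define z where "z = g v - g v'"
  have \<delta>: "0 < \<delta> / 8" and z: "0 < a \<bullet> z / 2"
    using v(3) \<open>\<not> a \<bullet> g v \<le> a \<bullet> g v'\<close> by (simp_all add: \<delta>_def z_def inner_diff_right)
  have p: "0 < N p" using grad pos by (auto simp: gradient_at_def)
  obtain R1 where R1: "\<And>R. R1 \<le> R \<Longrightarrow> \<bar>N (R *\<^sub>R p + v) - R * N p - a \<bullet> v\<bar> \<le> \<delta> / 8"
    using far_norm[OF grad \<delta>] by metis
  obtain R2 where R2: "\<And>R. R2 \<le> R \<Longrightarrow> \<bar>N (R *\<^sub>R p + v') - R * N p - a \<bullet> v'\<bar> \<le> \<delta> / 8"
    using far_norm[OF grad \<delta>] by metis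
  obtain R3 where R3: "\<And>R u. R3 \<le> R \<Longrightarrow> N u \<le> C + N v' + \<delta> / 8 \<Longrightarrow>
      \<bar>N (R *\<^sub>R p + u + z) - N (R *\<^sub>R p + u) - a \<bullet> z\<bar> \<le> a \<bullet> z / 2"
    using far_increment[OF grad z] by metis
  \<comment> \<open>\<open>R\<close> solves
    \<open>R * N p + a \<bullet> v + \<delta> / 2 = n\<close>, so \<open>n\<close> lies midway
    between the approximate distances to \<open>v\<close> and \<open>v'\<close>. The errors from
    \<open>far_norm\<close> and from \<open>w\<close> total at most \<delta>/4, and the ceiling puts
    \<open>R\<close> beyond all three thresholds.\<close>
  define n where "n = \<lceil>max R1 (max R2 R3) * N p + a \<bullet> v + \<delta> / 2\<rceil>"
  define R where "R = (of_int n - a \<bullet> v - \<delta> / 2) / N p"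
  have "max R1 (max R2 R3) * N p \<le> of_int n - a \<bullet> v - \<delta> / 2"
    unfolding n_def by linarith
  then have "max R1 (max R2 R3) \<le> R" unfolding R_def pos_le_divide_eq[OF p] .
  then have R: "R1 \<le> R" "R2 \<le> R" "R3 \<le> R" by simp_all
  have RN: "R * N p = of_int n - a \<bullet> v - \<delta> / 2" using p by (auto simp: R_def)
  obtain w where w: "w \<in> V" "N (w - - (R *\<^sub>R p)) < \<delta> / 8"
    using dense[OF V \<delta>] by metis
  have w': "N (w + R *\<^sub>R p) < \<delta> / 8" using w(2) by simp
  have "N (v - w) \<le> N (R *\<^sub>R p + v) + N (w + R *\<^sub>R p)"
    using diff_le[of "R *\<^sub>R p + v" "w + R *\<^sub>R p"] by simp
  then have "N (v - w) < of_int n"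
    using w' R1[OF R(1)] RN \<delta> by linarith
  then have "\<lfloor>N (v - w)\<rfloor> < n" by (simp add: floor_less_iff)
  moreover have "of_int n \<le> N (v' - w)"
  proof -
    have "N (R *\<^sub>R p + v') \<le> N (v' - w) + N (w + R *\<^sub>R p)"
      using triangle_sub[of "R *\<^sub>R p + v'" "v' - w"] by (simp add: add.commute)
    moreover have "a \<bullet> v' = a \<bullet> v + \<delta>" by (simp add: \<delta>_def)
    ultimately show ?thesis using w' R2[OF R(2)] RN \<delta> by linarith
  qed
  then have "n \<le> \<lfloor>N (v' - w)\<rfloor>" by (simp add: le_floor_iff)
  ultimately have "N (g v - g w) < N (g v' - g w)"
    using step[OF v(1) w(1)] step[OF v(2) w(1)] by linarith
  \<comment> \<open>\<open>u\<close> is the error of \<open>g v' - g w\<close> against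
    \<open>R p\<close>. Closeness of \<open>g\<close> to the identity bounds it independently of
    \<open>R\<close>, as the choice of \<open>R3\<close> demands.\<close>
  define u where "u = g v' - g w - R *\<^sub>R p"
  have "u = ((g v' - g w) - (v' - w)) + (v' - (w + R *\<^sub>R p))"
    by (simp add: u_def algebra_simps)
  then have "N u \<le> N ((g v' - g w) - (v' - w)) + N (v' - (w + R *\<^sub>R p))"
    using triangle by metis
  also have "\<dots> \<le> C + N v' + \<delta> / 8"
    using near[OF v(2) w(1)] diff_le[of v' "w + R *\<^sub>R p"] w' by simp
  finally have "\<bar>N (R *\<^sub>R p + u + z) - N (R *\<^sub>R p + u) - a \<bullet> z\<bar> \<le> a \<bullet> z / 2"
    by (rule R3[OF R(3)])
  then have "N (R *\<^sub>R p + u) < N (R *\<^sub>R p + u + z)"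
    using z by linarith
  moreover have "R *\<^sub>R p + u = g v' - g w" "R *\<^sub>R p + u + z = g v - g w"
    by (simp_all add: u_def z_def)
  ultimately show False using \<open>N (g v - g w) < N (g v' - g w)\<close> by (metis less_asym)
qed

theorem step_isometry_rigid:
  assumes not_max: "\<And>a b. det2 a b \<noteq> 0 \<Longrightarrow> \<exists>x. N x \<noteq> max \<bar>a \<bullet> x\<bar> \<bar>b \<bullet> x\<bar>"
    and V: "closure V = UNIV"
    and step: "\<And>u v. u \<in> V \<Longrightarrow> v \<in> V \<Longrightarrow> \<lfloor>N (f u - f v)\<rfloor> = \<lfloor>N (u - v)\<rfloor>"
    and uv: "u \<in> V" "v \<in> V"
  shows "N (f u - f v) = N (u - v)"
proof -
  obtain p a q b r c where grad: "gradient_at p a" "gradient_at q b" "gradient_at r c"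
    and det: "det2 a b \<noteq> 0" "det2 a c \<noteq> 0" "det2 b c \<noteq> 0"
    using three_gradients[OF not_max] by metis
  have "\<bar>N (f u - f v) - N (u - v)\<bar> \<le> 1" if "u \<in> V" "v \<in> V" for u v
    using step[OF that] by linarith
  then obtain g C where g: "\<And>u v. N (g u - g v) = N (f u - f v)"
    and near: "\<And>u v. u \<in> V \<Longrightarrow> v \<in> V \<Longrightarrow> N ((g u - g v) - (u - v)) \<le> C"
    using coarse_normalization[OF grad(1,2) det(1) V, of f] by metis
  have order: "d \<bullet> g u \<le> d \<bullet> g v" if "gradient_at o' d" "u \<in> V" "v \<in> V" "d \<bullet> u < d \<bullet> v" for o' d u v
    using gradient_order_preserved[OF that(1) V _ near that(2-4)] g step by simp
  \<comment> \<open>The three monotone directions are \<open>s a\<close>, \<open>t b\<close> and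
    their sum \<open>c\<close>.\<close>
  obtain s t where c: "c = s *\<^sub>R a + t *\<^sub>R b" using det2_basis[OF det(1)] by metis
  have st: "s \<noteq> 0" "t \<noteq> 0" using det(2,3) by (auto simp: c det2_def algebra_simps)
  \<comment> \<open>\<open>near\<close> controls only differences; translating so that
    \<open>u\<close> is fixed keeps \<open>h\<close> itself within \<open>C\<close> of the
    identity.\<close>
  define h where "h w = g w - g u + u" for w
  have h_near: "N (h w - w) \<le> C" if "w \<in> V" for w
    using near[OF that uv(1)] by (simp add: h_def algebra_simps)
  \<comment> \<open>A negative factor reverses both inequalities, so exchanging the two points
    handles it.\<close>
  have scaled_order: "(k *\<^sub>R d) \<bullet> h w \<le> (k *\<^sub>R d) \<bullet> h w'"
    if "gradient_at o' d" "w \<in> V" "w' \<in> V" "(k *\<^sub>R d) \<bullet> w < (k *\<^sub>R d) \<bullet> w'" for o' d k w w'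
  proof (cases "0 < k")
    case True
    then show ?thesis using order[OF that(1-3)] that(4)
      by (simp add: h_def inner_add_right inner_diff_right)
  next
    case False
    then have "k < 0" using that(4) by (cases "k = 0") auto
    then show ?thesis using order[OF that(1,3,2)] that(4)
      by (simp add: h_def inner_add_right inner_diff_right)
  qed
  let ?C = "\<bar>s\<bar> * C + \<bar>t\<bar> * C"
  have bound: "\<bar>(s *\<^sub>R a) \<bullet> h w - (s *\<^sub>R a) \<bullet> w\<bar> \<le> ?C" "\<bar>(t *\<^sub>R b) \<bullet> h w - (t *\<^sub>R b) \<bullet> w\<bar> \<le> ?C"
    if "w \<in> V" for w
  proof -
    have C: "0 \<le> C" using h_near[OF that] nonneg[of "h w - w"] by linarith
    have *: "\<bar>k * (d \<bullet> (h w - w))\<bar> \<le> \<bar>k\<bar> * C" if "gradient_at o' d" for k o' d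
      unfolding abs_mult
      using gradient_at_abs_le[OF that, of "h w - w"] h_near[OF \<open>w \<in> V\<close>]
      by (intro mult_left_mono) auto
    show "\<bar>(s *\<^sub>R a) \<bullet> h w - (s *\<^sub>R a) \<bullet> w\<bar> \<le> ?C" "\<bar>(t *\<^sub>R b) \<bullet> h w - (t *\<^sub>R b) \<bullet> w\<bar> \<le> ?C"
      using *[OF grad(1), of s] *[OF grad(2), of t] C
      by (simp_all add: inner_diff_right right_diff_distrib add_increasing add_increasing2)
  qed
  have sum_order: "(s *\<^sub>R a) \<bullet> h w + (t *\<^sub>R b) \<bullet> h w \<le> (s *\<^sub>R a) \<bullet> h w' + (t *\<^sub>R b) \<bullet> h w'"
    if "w \<in> V" "w' \<in> V" "(s *\<^sub>R a) \<bullet> w + (t *\<^sub>R b) \<bullet> w < (s *\<^sub>R a) \<bullet> w' + (t *\<^sub>R b) \<bullet> w'" for w w'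
    using scaled_order[OF grad(3) that(1,2), of 1] that(3) by (simp add: c inner_add_left)
  have det': "det2 (s *\<^sub>R a) (t *\<^sub>R b) \<noteq> 0" using st det(1) by simp
  have "\<exists>k. \<forall>w\<in>V. (s *\<^sub>R a) \<bullet> h w = (s *\<^sub>R a) \<bullet> w + k"
    by (rule monotone_in_three_directions[where y = "\<lambda>w. (t *\<^sub>R b) \<bullet> w" and Y = "\<lambda>w. (t *\<^sub>R b) \<bullet> h w" and C = ?C])
      (use scaled_order[OF grad(1)] scaled_order[OF grad(2)] sum_order bound
        dense_coordinates[OF det' V] in blast)+
  moreover have "\<exists>k. \<forall>w\<in>V. (t *\<^sub>R b) \<bullet> h w = (t *\<^sub>R b) \<bullet> w + k"
  proof (rule monotone_in_three_directions[where y = "\<lambda>w. (s *\<^sub>R a) \<bullet> w" and Y = "\<lambda>w. (s *\<^sub>R a) \<bullet> h w" and C = ?C])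
    show "(t *\<^sub>R b) \<bullet> h w + (s *\<^sub>R a) \<bullet> h w \<le> (t *\<^sub>R b) \<bullet> h w' + (s *\<^sub>R a) \<bullet> h w'"
      if "w \<in> V" "w' \<in> V" "(t *\<^sub>R b) \<bullet> w + (s *\<^sub>R a) \<bullet> w < (t *\<^sub>R b) \<bullet> w' + (s *\<^sub>R a) \<bullet> w'" for w w'
      using sum_order[of w w'] that by linarith
  qed (use scaled_order[OF grad(1)] scaled_order[OF grad(2)] bound
        dense_coordinates[OF det' V] in blast)+
  ultimately have "(s *\<^sub>R a) \<bullet> (h u - h v) = (s *\<^sub>R a) \<bullet> (u - v)"
    "(t *\<^sub>R b) \<bullet> (h u - h v) = (t *\<^sub>R b) \<bullet> (u - v)"
    using uv by (auto simp: inner_diff_right simp del: inner_scaleR_left)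
  moreover obtain e1 e2 where "\<And>x. x = ((s *\<^sub>R a) \<bullet> x) *\<^sub>R e1 + ((t *\<^sub>R b) \<bullet> x) *\<^sub>R e2"
    using det2_dual_basis[OF det'] by metis
  ultimately have "h u - h v = u - v" by metis
  then show ?thesis using g[of u v] by (simp add: h_def)
qed

end

section \<open>Parallelograms and maximum norms\<close>

text \<open>A point of the parallelogram is reached by interpolating along \<open>e\<close> on two
  opposite edges and then along \<open>f\<close> between the results. A free centre \<open>m\<close>
  is allowed because \<open>parallelogram\<close> does not prescribe one.\<close>

lemma convex_hull_parallelogram:
  fixes a b e f m :: plane
  assumes e: "a \<bullet> e = 1" "b \<bullet> e = 0" and f: "a \<bullet> f = 0" "b \<bullet> f = 1"
    and expand: "\<And>x. x = (a \<bullet> x) *\<^sub>R e + (b \<bullet> x) *\<^sub>R f"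
  shows "convex hull {m - e - f, m + e - f, m - e + f, m + e + f} =
    {x. \<bar>a \<bullet> (x - m)\<bar> \<le> 1 \<and> \<bar>b \<bullet> (x - m)\<bar> \<le> 1}" (is "?H = ?Q")
proof
  have slab: "{x. \<bar>c \<bullet> (x - m)\<bar> \<le> 1} = {x. c \<bullet> x \<le> 1 + c \<bullet> m} \<inter> {x. c \<bullet> x \<ge> c \<bullet> m - 1}" for c
    by (auto simp: inner_diff_right abs_le_iff)
  have "convex ?Q"
    unfolding Collect_conj_eq slab
    by (intro convex_Int convex_halfspace_le convex_halfspace_ge)
  then show "?H \<subseteq> ?Q"
    by (intro hull_minimal) (auto simp: inner_add_right inner_diff_right e f)
  show "?Q \<subseteq> ?H"
  proof
    fix x assume "x \<in> ?Q"
    define s where "s = a \<bullet> (x - m)"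
    define t where "t = b \<bullet> (x - m)"
    have st: "\<bar>s\<bar> \<le> 1" "\<bar>t\<bar> \<le> 1" using \<open>x \<in> ?Q\<close> by (simp_all add: s_def t_def)
    have x: "x = m + s *\<^sub>R e + t *\<^sub>R f" using expand[of "x - m"] by (simp add: s_def t_def algebra_simps)
    have mix: "((1 - r) / 2) *\<^sub>R y + ((1 + r) / 2) *\<^sub>R z \<in> ?H"
      if "y \<in> ?H" "z \<in> ?H" "\<bar>r\<bar> \<le> 1" for r y z
      using that by (intro convexD[OF convex_convex_hull]) (auto simp: field_simps)
    have half: "((1 - r) / 2) *\<^sub>R (y - z) + ((1 + r) / 2) *\<^sub>R (y + z) = y + r *\<^sub>R z" for r and y z :: plane
      by (simp add: vec_eq_iff field_simps)
    have "(m - f) - e = m - e - f" "(m - f) + e = m + e - f"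
      "(m + f) - e = m - e + f" "(m + f) + e = m + e + f"
      by simp_all
    then have "(m - f) - e \<in> ?H" "(m - f) + e \<in> ?H" "(m + f) - e \<in> ?H" "(m + f) + e \<in> ?H"
      by (auto intro: hull_inc)
    then have "(m - f) + s *\<^sub>R e \<in> ?H" "(m + f) + s *\<^sub>R e \<in> ?H"
      using mix[OF _ _ st(1), of "(m - f) - e" "(m - f) + e"]
        mix[OF _ _ st(1), of "(m + f) - e" "(m + f) + e"]
      unfolding half by blast+
    moreover have "(m - f) + s *\<^sub>R e = (m + s *\<^sub>R e) - f" "(m + f) + s *\<^sub>R e = (m + s *\<^sub>R e) + f"
      by simp_all
    ultimately show "x \<in> ?H"
      using mix[OF _ _ st(2), of "(m + s *\<^sub>R e) - f" "(m + s *\<^sub>R e) + f"]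
      unfolding half x by simp
  qed
qed

context plane_norm
begin

lemma parallelogram_if_max_norm:
  assumes det: "det2 a b \<noteq> 0" and N: "\<And>x. N x = max \<bar>a \<bullet> x\<bar> \<bar>b \<bullet> x\<bar>"
  shows "parallelogram {x. N x \<le> 1}"
proof -
  obtain e f where e: "a \<bullet> e = 1" "b \<bullet> e = 0" and f: "a \<bullet> f = 0" "b \<bullet> f = 1"
    and expand: "\<And>x. x = (a \<bullet> x) *\<^sub>R e + (b \<bullet> x) *\<^sub>R f"
    using det2_dual_basis[OF det] by metis
  have "\<not> collinear {- e - f, e - f, - e + f}"
  proof
    assume "collinear {- e - f, e - f, - e + f}"
    then have "collinear {0, 2 *\<^sub>R e, 2 *\<^sub>R f}"
      using collinear_3[of "e - f" "- e - f" "- e + f"] by (simp add: insert_commute scaleR_2)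
    then have "collinear {0, e, f}" by (simp add: collinear_scaleR_iff)
    then consider "e = 0" | "f = 0" | c where "f = c *\<^sub>R e" using collinear_lemma by blast
    then show False using e f by cases auto
  qed
  \<comment> \<open>The fourth corner \<open>e + f\<close> is written in the form
    \<open>b + c - a\<close> of the definition.\<close>
  moreover have "{x. N x \<le> 1} = convex hull {- e - f, e - f, - e + f, (e - f) + (- e + f) - (- e - f)}"
    using convex_hull_parallelogram[OF e f expand, of 0] by (simp add: N add.commute)
  ultimately show ?thesis unfolding parallelogram_def by blast
qed

lemma max_norm_if_parallelogram:
  assumes "parallelogram {x. N x \<le> 1}"
  obtains a b where "det2 a b \<noteq> 0" "\<And>x. N x = max \<bar>a \<bullet> x\<bar> \<bar>b \<bullet> x\<bar>"
proof -
  obtain A B C where ABC: "\<not> collinear {A, B, C}"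
    "{x. N x \<le> 1} = convex hull {A, B, C, B + C - A}"
    using assms unfolding parallelogram_def by blast
  \<comment> \<open>Half-edges and centre; the functionals sought are dual to the
    half-edges.\<close>
  define e where "e = (1/2) *\<^sub>R (B - A)"
  define f where "f = (1/2) *\<^sub>R (C - A)"
  define m where "m = (1/2) *\<^sub>R (B + C)"
  have corners: "A = m - e - f" "B = m + e - f" "C = m - e + f" "B + C - A = m + e + f"
    by (simp_all add: e_def f_def m_def vec_eq_iff field_simps)
  have "det2 e f \<noteq> 0"
  proof
    assume "det2 e f = 0"
    then obtain s t where st: "s \<noteq> 0 \<or> t \<noteq> 0" "s *\<^sub>R e + t *\<^sub>R f = 0"
      unfolding det2_eq_0_iff by blast
    have "collinear {0, e, f}"
    proof (cases "t = 0")
      case True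
      then show ?thesis using st by (simp add: collinear_lemma)
    next
      case False
      have "t *\<^sub>R f = (- s) *\<^sub>R e" using st(2) by (simp add: add_eq_0_iff2)
      then have "(1 / t) *\<^sub>R (t *\<^sub>R f) = (1 / t) *\<^sub>R ((- s) *\<^sub>R e)" by simp
      then have "f = (- s / t) *\<^sub>R e" using False by simp
      then show ?thesis unfolding collinear_lemma by blast
    qed
    then have "collinear {0, B - A, C - A}" by (simp add: e_def f_def collinear_scaleR_iff)
    then show False using ABC(1) collinear_3[of B A C] by (simp add: insert_commute)
  qed
  then obtain a b where ab: "e \<bullet> a = 1" "e \<bullet> b = 0" "f \<bullet> a = 0" "f \<bullet> b = 1" "det2 a b \<noteq> 0"
    and expand: "\<And>x. x = (a \<bullet> x) *\<^sub>R e + (b \<bullet> x) *\<^sub>R f"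
    using det2_dual_basis by metis
  have ef: "a \<bullet> e = 1" "b \<bullet> e = 0" "a \<bullet> f = 0" "b \<bullet> f = 1"
    using ab by (simp_all add: inner_commute)
  have "{A, B, C, B + C - A} = {m - e - f, m + e - f, m - e + f, m + e + f}"
    by (simp only: corners(4)) (simp only: corners(1-3))
  then have hull: "convex hull {A, B, C, B + C - A} =
      {x. \<bar>a \<bullet> (x - m)\<bar> \<le> 1 \<and> \<bar>b \<bullet> (x - m)\<bar> \<le> 1}"
    using convex_hull_parallelogram[OF ef expand, of m] by simp
  have ball: "N x \<le> 1 \<longleftrightarrow> \<bar>a \<bullet> (x - m)\<bar> \<le> 1 \<and> \<bar>b \<bullet> (x - m)\<bar> \<le> 1" for x
    using ABC(2) unfolding hull set_eq_iff mem_Collect_eq by blast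
  have "N (m + e) \<le> 1" "N (m - e) \<le> 1" "N (m + f) \<le> 1" "N (m - f) \<le> 1"
    by (simp_all add: ball ef)
  \<comment> \<open>The ball also contains the negatives of the edge midpoints, which forces its
    centre \<open>m\<close> to have both coordinates 0.\<close>
  then have "N (- (m + e)) \<le> 1" "N (- (m - e)) \<le> 1" "N (- (m + f)) \<le> 1" "N (- (m - f)) \<le> 1"
    by (simp_all only: minus)
  then have "a \<bullet> m = 0" "b \<bullet> m = 0"
    unfolding ball inner_diff_right inner_add_right inner_minus_right ef by (simp_all add: abs_le_iff)
  then have unit: "N x \<le> 1 \<longleftrightarrow> max \<bar>a \<bullet> x\<bar> \<bar>b \<bullet> x\<bar> \<le> 1" for x
    by (simp add: ball inner_diff_right)
  \<comment> \<open>Homogeneity passes from the unit ball to balls of every positive radius, and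
    these determine the norm.\<close>
  have ball: "N x \<le> r \<longleftrightarrow> max \<bar>a \<bullet> x\<bar> \<bar>b \<bullet> x\<bar> \<le> r" if "0 < r" for x r
    using unit[of "(1 / r) *\<^sub>R x"] that by (simp add: scale abs_mult)
  have "N x = max \<bar>a \<bullet> x\<bar> \<bar>b \<bullet> x\<bar>" for x
  proof (rule antisym; rule field_le_epsilon)
    fix \<epsilon> :: real assume \<epsilon>: "0 < \<epsilon>"
    have "0 < max \<bar>a \<bullet> x\<bar> \<bar>b \<bullet> x\<bar> + \<epsilon>" using \<epsilon> by linarith
    from ball[OF this, of x] show "N x \<le> max \<bar>a \<bullet> x\<bar> \<bar>b \<bullet> x\<bar> + \<epsilon>" using \<epsilon> by linarith
    have "0 < N x + \<epsilon>" using \<epsilon> nonneg[of x] by linarith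
    from ball[OF this, of x] show "max \<bar>a \<bullet> x\<bar> \<bar>b \<bullet> x\<bar> \<le> N x + \<epsilon>" using \<epsilon> by linarith
  qed
  then show ?thesis using that ab(5) by blast
qed

end

section \<open>A step-isometry of the maximum norm that is not an isometry\<close>

text \<open>Squaring the fractional part is increasing on the unit interval, fixes the integers,
  keeps rationals rational and moves 1/2 to 1/4.\<close>

definition bend :: "real \<Rightarrow> real" where
  "bend t = of_int \<lfloor>t\<rfloor> + (frac t)\<^sup>2"

lemma bend_add_int: "bend (t + of_int n) = bend t + of_int n"
  by (simp add: bend_def frac_def)

lemma bend_strict_mono:
  assumes "s < t"
  shows "bend s < bend t"
proof (cases "\<lfloor>s\<rfloor> = \<lfloor>t\<rfloor>")
  case True
  then have "frac s < frac t" using assms by (simp add: frac_def)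
  then have "(frac s)\<^sup>2 < (frac t)\<^sup>2" by (intro power_strict_mono) auto
  then show ?thesis using True by (simp add: bend_def)
next
  case False
  then have "\<lfloor>s\<rfloor> < \<lfloor>t\<rfloor>" using floor_mono[of s t] assms by simp
  then have "of_int \<lfloor>s\<rfloor> + 1 \<le> (of_int \<lfloor>t\<rfloor> :: real)" by linarith
  moreover have "(frac s)\<^sup>2 < 1" using frac_lt_1[of s] by (simp add: power_less_one_iff abs_square_less_1)
  moreover have "0 \<le> (frac t)\<^sup>2" by simp
  ultimately show ?thesis unfolding bend_def by linarith
qed

lemma bend_le_iff: "bend s \<le> bend t \<longleftrightarrow> s \<le> t"
  using bend_strict_mono[of s t] bend_strict_mono[of t s] by (cases s t rule: linorder_cases) auto

text \<open>An integer \<open>n\<close> is at most \<open>s - t\<close> iff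
  \<open>t + n \<le> s\<close>, a relation that \<open>bend\<close> preserves and reflects because
  it is increasing and commutes with integer shifts.\<close>

lemma floor_abs_bend_diff: "\<lfloor>\<bar>bend s - bend t\<bar>\<rfloor> = \<lfloor>\<bar>s - t\<bar>\<rfloor>"
proof -
  have *: "\<lfloor>bend s - bend t\<rfloor> = \<lfloor>s - t\<rfloor>" for s t
  proof -
    have "n \<le> \<lfloor>bend s - bend t\<rfloor> \<longleftrightarrow> n \<le> \<lfloor>s - t\<rfloor>" for n
      using bend_le_iff[of "t + of_int n" s] by (auto simp: bend_add_int le_floor_iff algebra_simps)
    then show ?thesis by (metis antisym order_refl)
  qed
  show ?thesis
    using *[of s t] *[of t s] bend_strict_mono[of s t] bend_strict_mono[of t s]
    by (cases s t rule: linorder_cases) simp_all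
qed

text \<open>The dense set consists of the points with rational coordinates, and \<open>F\<close>
  bends the first coordinate only.\<close>

lemma not_truncating_if_max_norm:
  assumes det: "det2 a b \<noteq> 0" and d: "\<And>x y. d x y = max \<bar>a \<bullet> (x - y)\<bar> \<bar>b \<bullet> (x - y)\<bar>"
  shows "\<not> truncating_property d"
proof
  assume trunc: "truncating_property d"
  obtain e f where ef: "a \<bullet> e = 1" "a \<bullet> f = 0" "b \<bullet> e = 0" "b \<bullet> f = 1"
    and expand: "\<And>x. x = (a \<bullet> x) *\<^sub>R e + (b \<bullet> x) *\<^sub>R f"
    using det2_dual_basis[OF det] by metis
  let ?c = "\<lambda>(s, t). s *\<^sub>R e + t *\<^sub>R f"
  define V where "V = ?c ` (\<rat> \<times> \<rat>)"
  define F where "F x = bend (a \<bullet> x) *\<^sub>R e + (b \<bullet> x) *\<^sub>R f" for x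
  have F: "a \<bullet> F x = bend (a \<bullet> x)" "b \<bullet> F x = b \<bullet> x" for x
    by (simp_all add: F_def inner_add_right ef)
  have V: "countable V" by (simp add: V_def countable_rat)
  have closure_V: "closure V = UNIV"
  proof -
    have "?c ` closure (\<rat> \<times> \<rat>) \<subseteq> closure V"
      unfolding V_def
      by (rule image_closure_subset[OF _ closed_closure closure_subset])
        (auto simp: case_prod_unfold intro!: continuous_intros)
    moreover have "x \<in> range ?c" for x using expand[of x] by (auto simp: image_iff)
    ultimately show ?thesis by (auto simp: closure_Times Rats_closure_real)
  qed
  have "F \<in> V \<rightarrow> V"
  proof
    fix x assume "x \<in> V"
    then obtain s t where st: "s \<in> \<rat>" "t \<in> \<rat>" "x = s *\<^sub>R e + t *\<^sub>R f" by (auto simp: V_def)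
    then have "F x = ?c (bend s, t)" by (simp add: F_def inner_add_right ef)
    moreover have "bend s \<in> \<rat>" using st(1) by (auto simp: bend_def frac_def)
    ultimately show "F x \<in> V" unfolding V_def using st(2) by (intro image_eqI[of _ _ "(bend s, t)"]) auto
  qed
  \<comment> \<open>Since \<open>floor\<close> commutes with \<open>max\<close>, step-isometry can
    be checked coordinate by coordinate.\<close>
  moreover have "\<lfloor>max x y\<rfloor> = max \<lfloor>x\<rfloor> \<lfloor>y\<rfloor>" for x y :: real
    using max_of_mono[of floor x y] by (simp add: monoI floor_mono)
  ultimately have "step_isometry_on d V F"
    by (simp add: step_isometry_on_def d F inner_diff_right floor_abs_bend_diff)
  then have "isometry_on d V F"
    using trunc V closure_V unfolding truncating_property_def by blast
  \<comment> \<open>The distance between these two points drops from 1/2 to 1/4.\<close>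
  moreover have "?c (1/2, 0) \<in> V" "?c (0, 0) \<in> V"
    unfolding V_def by (intro imageI; auto)+
  ultimately have "d (F (?c (1/2, 0))) (F (?c (0, 0))) = d (?c (1/2, 0)) (?c (0, 0))"
    unfolding isometry_on_def by blast
  then show False
    by (simp add: d F inner_diff_right inner_add_right ef bend_def frac_def power2_eq_square)
qed

theorem theorem2:
  fixes d :: "plane \<Rightarrow> plane \<Rightarrow> real"
  assumes "d \<in> Omega"
  shows "truncating_property d \<longleftrightarrow> \<not> box_metric d"
proof -
  obtain N where N: "is_norm N" "\<And>x y. d x y = N (x - y)"
    using assms by (auto simp: Omega_def polygonal_metric_def smooth_metric_def norm_derived_def)
  interpret plane_norm N by standard (rule N(1))
  \<comment> \<open>Membership in \<open>Omega\<close> is given, so only the shape matters, and it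
    is a parallelogram exactly when \<open>N\<close> is the maximum of two independent functionals
    in absolute value.\<close>
  have box: "box_metric d \<longleftrightarrow> parallelogram {x. N x \<le> 1}"
    using assms by (simp add: box_metric_def shape_def N(2))
  show ?thesis
  proof
    assume trunc: "truncating_property d"
    show "\<not> box_metric d"
    proof
      assume "box_metric d"
      then obtain a b where "det2 a b \<noteq> 0" "\<And>x. N x = max \<bar>a \<bullet> x\<bar> \<bar>b \<bullet> x\<bar>"
        using box max_norm_if_parallelogram by metis
      then show False using not_truncating_if_max_norm[of a b d] trunc N(2) by simp
    qed
  next
    assume "\<not> box_metric d"
    then have not_max: "\<exists>x. N x \<noteq> max \<bar>a \<bullet> x\<bar> \<bar>b \<bullet> x\<bar>" if "det2 a b \<noteq> 0" for a b
      using parallelogram_if_max_norm[OF that] box by blast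
    show "truncating_property d"
      unfolding truncating_property_def
    proof (intro allI impI)
      fix V f assume V: "countable V \<and> closure V = UNIV \<and> step_isometry_on d V f"
      then have "N (f u - f v) = N (u - v)" if "u \<in> V" "v \<in> V" for u v
        using step_isometry_rigid[OF not_max, of V f u v] that by (simp add: step_isometry_on_def N(2))
      then show "isometry_on d V f"
        using V by (simp add: isometry_on_def step_isometry_on_def N(2))
    qed
  qed
qed

end
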